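(* Let $\Gamma\subset\mathbb R^n$ be an open symmetric convex cone satisfying $\Gamma_n\subset\Gamma\subset\Gamma_1$. Then there is a symmetric function $f_\Gamma\in C^\infty(\Gamma)\cap C(\overline\Gamma)$ such that: (i) $\partial f_\Gamma/\partial\lambda_i>0$ on $\Gamma$ for $1\le i\le n$; $f_\Gamma$ is concave and positive on $\Gamma$; and $f_\Gamma=0$ on $\partial\Gamma$; (ii) $f_\Gamma$ is homogeneous of degree one; (iii) for the spectral function $F(A)=f_\Gamma(\lambda(A))$ there is a constant $\gamma_0>0$ such that, in every unitary frame, $\det\left(\frac{\partial F}{\partial A_{i\bar j}}(A)\right)\ge\gamma_0$ whenever $\lambda(A)\in\Gamma$.
   Context: $\Gamma_n=\{\lambda\in\mathbb R^n:\lambda_i>0\text{ for all }i\}$ and $\Gamma_1=\{\lambda\in\mathbb R^n:\sum_i\lambda_i>0\}$. "Symmetric" means invariant under permutations of the coordinates. For an $n\times n$ Hermitian matrix $A$, $\lambda(A)\in\mathbb R^n$ denotes its eigenvalues. *)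

theory Defs
  imports "HOL-Analysis.Analysis"
begin

definition symmetric_set :: "(real ^ 'n) set \<Rightarrow> bool" where
  "symmetric_set S \<longleftrightarrow> (\<forall>x\<in>S. \<forall>p. p permutes (UNIV :: 'n set) \<longrightarrow> (\<chi> i. x $ p i) \<in> S)"

definition symmetric_on :: "(real ^ 'n) set \<Rightarrow> (real ^ 'n \<Rightarrow> real) \<Rightarrow> bool" where
  "symmetric_on S f \<longleftrightarrow>
     (\<forall>x\<in>S. \<forall>p. p permutes (UNIV :: 'n set) \<longrightarrow> f (\<chi> i. x $ p i) = f x)"

(* The library predicate "cone" puts the apex 0 into every nonempty cone, so no open
   set contained in Gamma_1 satisfies it unless it is empty; only positive dilations
   are allowed here. *)
definition dilation_invariant :: "(real ^ 'n) set \<Rightarrow> bool" where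
  "dilation_invariant S \<longleftrightarrow> (\<forall>x\<in>S. \<forall>t>0. t *\<^sub>R x \<in> S)"

definition Gamma_n :: "(real ^ 'n) set" where
  "Gamma_n = {l. \<forall>i. 0 < l $ i}"

definition Gamma_1 :: "(real ^ 'n) set" where
  "Gamma_1 = {l. 0 < (\<Sum>i\<in>UNIV. l $ i)}"

(* Intended for open S. *)
primrec Ck_on :: "nat \<Rightarrow> ('a::real_normed_vector) set \<Rightarrow> ('a \<Rightarrow> 'b::real_normed_vector) \<Rightarrow> bool" where
  "Ck_on 0 S f \<longleftrightarrow> continuous_on S f"
| "Ck_on (Suc k) S f \<longleftrightarrow>
     (\<forall>x\<in>S. f differentiable (at x)) \<and> (\<forall>v. Ck_on k S (\<lambda>x. frechet_derivative f (at x) v))"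

definition smooth_on :: "('a::real_normed_vector) set \<Rightarrow> ('a \<Rightarrow> 'b::real_normed_vector) \<Rightarrow> bool" where
  "smooth_on S f \<longleftrightarrow> (\<forall>k. Ck_on k S f)"

definition partial_deriv :: "'n \<Rightarrow> (real ^ 'n \<Rightarrow> real) \<Rightarrow> real ^ 'n \<Rightarrow> real" where
  "partial_deriv i f x = deriv (\<lambda>t. f (x + t *\<^sub>R axis i 1)) 0"

definition conj_transpose :: "complex ^ 'n ^ 'm \<Rightarrow> complex ^ 'm ^ 'n" where
  "conj_transpose A = (\<chi> i j. cnj (A $ j $ i))"

definition hermitian :: "complex ^ 'n ^ 'n \<Rightarrow> bool" where
  "hermitian A \<longleftrightarrow> conj_transpose A = A"

definition unitary :: "complex ^ 'n ^ 'n \<Rightarrow> bool" where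
  "unitary U \<longleftrightarrow> conj_transpose U ** U = mat 1 \<and> U ** conj_transpose U = mat 1"

(* The entries of l are the roots of the characteristic polynomial, with multiplicity. *)
definition eigenvalue_vector :: "complex ^ 'n ^ 'n \<Rightarrow> real ^ 'n \<Rightarrow> bool" where
  "eigenvalue_vector A l \<longleftrightarrow>
     (\<forall>z. det (mat z - A) = (\<Prod>i\<in>UNIV. z - complex_of_real (l $ i)))"

(* The order of the eigenvalues is left arbitrary: eigvals is only used with symmetric
   sets and functions.  Such a vector exists for every hermitian A. *)
definition eigvals :: "complex ^ 'n ^ 'n \<Rightarrow> real ^ 'n" where
  "eigvals A = (SOME l. eigenvalue_vector A l)"

definition spectral_fun :: "(real ^ 'n \<Rightarrow> real) \<Rightarrow> complex ^ 'n ^ 'n \<Rightarrow> real" where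
  "spectral_fun f A = f (eigvals A)"

(* G is the matrix of the partial derivatives of F with respect to the entries of A, for
   a function F of hermitian matrices: G is hermitian, and dF = sum_ij G_ij dA_ij along the
   real vector space of hermitian matrices.  Off the diagonal these are the Wirtinger
   derivatives of F, with A_ji the conjugate of the complex coordinate A_ij for i < j.
   On hermitian H the double sum is real, so Re only adjusts the type. *)
definition has_hermitian_gradient ::
    "(complex ^ 'n ^ 'n \<Rightarrow> real) \<Rightarrow> complex ^ 'n ^ 'n \<Rightarrow> complex ^ 'n ^ 'n \<Rightarrow> bool" where
  "has_hermitian_gradient F A G \<longleftrightarrow>
     hermitian G \<and>
     (F has_derivative (\<lambda>H. Re (\<Sum>i\<in>UNIV. \<Sum>j\<in>UNIV. G $ i $ j * H $ i $ j)))
       (at A within {H. hermitian H})"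

lemma hermitian_entry: "cnj (A $ i $ j) = A $ j $ i" if "hermitian A"
proof -
  have "conj_transpose A $ j $ i = A $ j $ i"
    using that by (simp add: hermitian_def)
  then show ?thesis
    by (simp add: conj_transpose_def)
qed

lemma hermitian_gradient_unique:
  fixes A G G' :: "complex ^ 'n ^ 'n"
  assumes A: "hermitian A"
    and G: "has_hermitian_gradient F A G" and G': "has_hermitian_gradient F A G'"
  shows "G = G'"
proof -
  define S where "S = {H::complex ^ 'n ^ 'n. hermitian H}"
  define D where "D G H = Re (\<Sum>i\<in>UNIV. \<Sum>j\<in>UNIV. G $ i $ j * H $ i $ j)"
    for G H :: "complex ^ 'n ^ 'n"
  have dG: "(F has_derivative D K) (at A within S)" if "has_hermitian_gradient F A K" for K
    using that unfolding has_hermitian_gradient_def S_def D_def by blast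
  define H :: "complex ^ 'n ^ 'n" where "H = (\<chi> i j. cnj (G $ i $ j - G' $ i $ j))"
  have hG: "cnj (G $ i $ j) = G $ j $ i" "cnj (G' $ i $ j) = G' $ j $ i" for i j
    using G G' by (auto simp: has_hermitian_gradient_def intro: hermitian_entry)
  have hA: "cnj (A $ i $ j) = A $ j $ i" for i j
    using A by (rule hermitian_entry)
  have line: "A + t *\<^sub>R H \<in> S" for t
    unfolding S_def hermitian_def conj_transpose_def H_def
    by (simp add: vec_eq_iff hG hA)
  have scal: "D K (t *\<^sub>R H) = t * D K H" for K t
    unfolding D_def by (simp add: sum_distrib_left algebra_simps)
  have along: "((\<lambda>t. F (A + t *\<^sub>R H)) has_real_derivative D K H) (at 0)"
    if "has_hermitian_gradient F A K" for K
  proof -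
    have l: "((\<lambda>t. A + t *\<^sub>R H) has_derivative (\<lambda>t. t *\<^sub>R H)) (at 0)"
      by (auto intro!: derivative_eq_intros)
    have "(F has_derivative D K) (at (A + 0 *\<^sub>R H) within (\<lambda>t. A + t *\<^sub>R H) ` UNIV)"
      using has_derivative_subset[OF dG[OF that]] line by (simp add: image_subset_iff)
    then have "((\<lambda>t. F (A + t *\<^sub>R H)) has_derivative (\<lambda>t. D K (t *\<^sub>R H))) (at 0)"
      using has_derivative_in_compose[OF l] by blast
    then show ?thesis
      unfolding has_field_derivative_def scal by (simp add: mult.commute[of _ "D K H"])
  qed
  have "D G H = D G' H"
    using DERIV_unique[OF along[OF G] along[OF G']] .
  then have "(\<Sum>i\<in>UNIV. \<Sum>j\<in>UNIV. Re ((G $ i $ j - G' $ i $ j) * H $ i $ j)) = 0"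
    unfolding D_def by (simp add: sum_subtractf left_diff_distrib)
  moreover have "Re ((G $ i $ j - G' $ i $ j) * H $ i $ j) = (cmod (G $ i $ j - G' $ i $ j))\<^sup>2"
    for i j
    unfolding H_def vec_lambda_beta complex_mult_cnj cmod_power2 by simp
  ultimately have "(\<Sum>i\<in>UNIV. \<Sum>j\<in>UNIV. (cmod (G $ i $ j - G' $ i $ j))\<^sup>2) = 0"
    by simp
  then have "\<forall>i j. (cmod (G $ i $ j - G' $ i $ j))\<^sup>2 = 0"
    by (subst (asm) sum_nonneg_eq_0_iff) (auto intro: sum_nonneg simp: sum_nonneg_eq_0_iff)
  then show ?thesis
    by (simp add: vec_eq_iff)
qed

end

theory Submission
  imports Defs
begin

text \<open>
  Let \<open>n\<close> be the dimension and let \<open>K\<close> be the slice \<open>\<Sum> y\<^sub>i = 1\<close> of the dual cone of \<open>\<Gamma>\<close>.  It is a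
  nonempty compact convex set, invariant under permutations, and a point \<open>x\<close> of the closure of \<open>\<Gamma>\<close>
  lies on the boundary exactly if \<open>x \<bullet> y = 0\<close> for some \<open>y\<close> in \<open>K\<close>.  Let \<open>\<mu>\<close> be the image of the
  Lebesgue measure of the unit cube under the nearest point projection to \<open>K\<close>.  The function
  \<open>\<phi> x = \<integral> (x \<bullet> y) ^ (- (n + 1)) d\<mu>(y)\<close> is smooth, symmetric and convex on \<open>\<Gamma>\<close> and homogeneous of
  degree \<open>- (n + 1)\<close>.  Hence \<open>m = \<phi> powr (- 1 / (n + 1))\<close> is homogeneous of degree one with convex
  superlevel sets, which makes it concave (\<open>mean_superadditive\<close>).  Near a boundary point the
  integrand is at least of order \<open>r ^ (- (n + 1))\<close> on a set of measure of order \<open>r ^ n\<close>, so \<open>\<phi>\<close> tends to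
  infinity and \<open>m\<close> to zero (\<open>mean_tendsto_frontier\<close>).

  The function of the theorem is \<open>f = (m s ^ (n - 1)) powr (1 / n)\<close>, where \<open>s\<close> is the sum of the
  coordinates.  It inherits the properties of \<open>m\<close>.  On the positive orthant every \<open>y\<close> in \<open>K\<close> averages
  the coordinates, so \<open>m\<close> is at least the smallest coordinate, and therefore \<open>f ^ n\<close> is at least the
  product of the coordinates (\<open>profile_power_ge_prod\<close>).  Concavity and homogeneity give
  \<open>\<nabla>f(x) \<bullet> v \<ge> f(v)\<close> for \<open>x\<close> and \<open>v\<close> in \<open>\<Gamma>\<close>.  With \<open>v\<^sub>i = 1 / \<partial>\<^sub>i f(x)\<close> this yields
  \<open>\<Prod> \<partial>\<^sub>i f(x) \<ge> n ^ (- n)\<close> (\<open>prod_ge_of_dual_arithmetic_geometric\<close>).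

  It remains to see that the spectral function of \<open>f\<close> is differentiable at \<open>A = V diag(a) V\<^sup>*\<close> and that
  its derivative is represented by \<open>V diag(\<nabla>f(a)) V\<^sup>*\<close>, whose determinant is \<open>\<Prod> \<partial>\<^sub>i f(a)\<close>.  This
  matrix is a supergradient at \<open>A\<close>, by a rearrangement inequality for doubly stochastic matrices
  (\<open>spectral_below_tangent\<close>).  It is determined by \<open>A\<close>, by the symmetry of \<open>f\<close>, and then depends
  continuously on \<open>A\<close>, by compactness of the unitary group.  A concave function with a continuous
  choice of supergradients is differentiable (\<open>spectral_has_derivative\<close>).
\<close>

section \<open>Calculus of iterated differentiability\<close>

lemma Ck_on_cong:
  assumes "open S" and "\<And>x. x \<in> S \<Longrightarrow> f x = g x" and "Ck_on k S f"
  shows "Ck_on k S g"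
  using assms(2,3)
proof (induction k arbitrary: f g)
  case 0
  then show ?case
    using continuous_on_cong by fastforce
next
  case (Suc k)
  have der: "(g has_derivative frechet_derivative f (at x)) (at x)" if "x \<in> S" for x
  proof (rule has_derivative_transform_within_open)
    show "(f has_derivative frechet_derivative f (at x)) (at x)"
      using Suc.prems(2) that by (simp flip: frechet_derivative_works)
  qed (use assms(1) Suc.prems(1) that in auto)
  have "frechet_derivative f (at x) v = frechet_derivative g (at x) v" if "x \<in> S" for x v
    using frechet_derivative_at[OF der[OF that]] by simp
  then have "Ck_on k S (\<lambda>x. frechet_derivative g (at x) v)" for v
    using Suc.IH[of "\<lambda>x. frechet_derivative f (at x) v"] Suc.prems(2) by simp
  then show ?case
    using der by (auto simp: differentiable_def)
qed

text \<open>The predicate refers to a derivative chosen by \<open>frechet_derivative\<close>; this rule replaces it by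
  any explicit formula for the derivative on \<open>S\<close>.\<close>

lemma Ck_on_SucI:
  assumes S: "open S" and der: "\<And>x. x \<in> S \<Longrightarrow> (f has_derivative f' x) (at x)"
    and f': "\<And>v. Ck_on k S (\<lambda>x. f' x v)"
  shows "Ck_on (Suc k) S f"
proof -
  have "f' x v = frechet_derivative f (at x) v" if "x \<in> S" for x v
    using frechet_derivative_at[OF der[OF that]] by simp
  then have "Ck_on k S (\<lambda>x. frechet_derivative f (at x) v)" for v
    by (rule Ck_on_cong[OF S _ f'])
  then show ?thesis
    using der by (auto simp: differentiable_def)
qed

lemma Ck_on_Suc_has_derivative:
  assumes "Ck_on (Suc k) S f" and "x \<in> S"
  shows "(f has_derivative frechet_derivative f (at x)) (at x)"
  using assms by (simp flip: frechet_derivative_works)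

lemma Ck_on_Suc_imp:
  assumes "Ck_on (Suc k) S f"
  shows "Ck_on k S f"
  using assms
proof (induction k arbitrary: f)
  case 0
  then show ?case
    by (simp add: continuous_at_imp_continuous_on differentiable_imp_continuous_within)
next
  case (Suc k)
  then show ?case
    by (metis Ck_on.simps(2))
qed

lemma Ck_on_const: "open S \<Longrightarrow> Ck_on k S (\<lambda>x. c)"
  by (induction k arbitrary: c) auto

lemma Ck_on_bounded_linear:
  assumes "open S" and "bounded_linear f"
  shows "Ck_on k S f"
proof (cases k)
  case 0
  then show ?thesis
    using assms(2) by (simp add: linear_continuous_on)
next
  case (Suc j)
  then show ?thesis
    using Ck_on_SucI[OF assms(1) bounded_linear_imp_has_derivative[OF assms(2)]]
      Ck_on_const[OF assms(1)] by blast
qed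

lemma Ck_on_add:
  assumes "open S" and "Ck_on k S f" and "Ck_on k S g"
  shows "Ck_on k S (\<lambda>x. f x + g x)"
  using assms(2,3)
proof (induction k arbitrary: f g)
  case 0
  then show ?case
    by (simp add: continuous_on_add)
next
  case (Suc k)
  show ?case
    by (rule Ck_on_SucI[OF assms(1)
          has_derivative_add[OF Ck_on_Suc_has_derivative[OF Suc.prems(1)]
            Ck_on_Suc_has_derivative[OF Suc.prems(2)]]])
      (use Suc in auto)
qed

lemma Ck_on_mult:
  fixes f g :: "'a::real_normed_vector \<Rightarrow> real"
  assumes "open S" and "Ck_on k S f" and "Ck_on k S g"
  shows "Ck_on k S (\<lambda>x. f x * g x)"
  using assms(2,3)
proof (induction k arbitrary: f g)
  case 0
  then show ?case
    by (simp add: continuous_on_mult)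
next
  case (Suc k)
  show ?case
    by (rule Ck_on_SucI[OF assms(1)
          has_derivative_mult[OF Ck_on_Suc_has_derivative[OF Suc.prems(1)]
            Ck_on_Suc_has_derivative[OF Suc.prems(2)]]])
      (use Suc Ck_on_Suc_imp[OF Suc.prems(1)] Ck_on_Suc_imp[OF Suc.prems(2)] in
        \<open>auto intro!: Ck_on_add[OF assms(1)]\<close>)
qed

lemma Ck_on_power:
  fixes f :: "'a::real_normed_vector \<Rightarrow> real"
  assumes "open S" and "Ck_on k S f"
  shows "Ck_on k S (\<lambda>x. f x ^ m)"
  by (induction m) (use assms in \<open>auto intro: Ck_on_const Ck_on_mult\<close>)

lemma Ck_on_powr:
  fixes f :: "'a::real_normed_vector \<Rightarrow> real"
  assumes "open S" and "Ck_on k S f" and pos: "\<And>x. x \<in> S \<Longrightarrow> 0 < f x"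
  shows "Ck_on k S (\<lambda>x. f x powr c)"
  using assms(2)
proof (induction k arbitrary: c)
  case 0
  have "\<forall>x\<in>S. f x \<noteq> 0"
    using pos by force
  then show ?case
    using 0 by (auto intro!: continuous_intros)
next
  case (Suc k)
  have der: "((\<lambda>x. f x powr c) has_derivative
      (\<lambda>v. c * f x powr (c - 1) * frechet_derivative f (at x) v)) (at x)" if "x \<in> S" for x
  proof -
    have "((\<lambda>t. t powr c) has_derivative (\<lambda>v. c * f x powr (c - 1) * v)) (at (f x))"
      using has_real_derivative_powr[of "f x" c] pos[OF that]
      by (simp add: has_field_derivative_def)
    from has_derivative_compose[OF Ck_on_Suc_has_derivative[OF Suc.prems that] this]
    show ?thesis .
  qed
  show ?case
    by (rule Ck_on_SucI[OF assms(1) der])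
      (use Suc Ck_on_Suc_imp[OF Suc.prems] in
        \<open>auto intro!: Ck_on_mult[OF assms(1)] Ck_on_const[OF assms(1)]\<close>)
qed

section \<open>Unitary matrices and the trace inner product\<close>

lemma conj_transpose_nth: "conj_transpose A $ i $ j = cnj (A $ j $ i)"
  by (simp add: conj_transpose_def)

lemma conj_transpose_mult: "conj_transpose (A ** B) = conj_transpose B ** conj_transpose A"
  by (simp add: vec_eq_iff conj_transpose_nth matrix_matrix_mult_def mult.commute)

lemma conj_transpose_conj_transpose [simp]: "conj_transpose (conj_transpose A) = A"
  by (simp add: vec_eq_iff conj_transpose_nth)

lemma unitary_conj_transpose: "unitary U \<Longrightarrow> unitary (conj_transpose U)"
  by (simp add: unitary_def)

lemma unitary_mult:
  assumes "unitary U" and "unitary V"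
  shows "unitary (U ** V)"
  using assms unfolding unitary_def conj_transpose_mult
  by (metis matrix_mul_assoc matrix_mul_rid)

lemma unitary_cancel:
  assumes "unitary U"
  shows "conj_transpose U ** (U ** A) = A" and "U ** (conj_transpose U ** A) = A"
    and "(A ** U) ** conj_transpose U = A" and "(A ** conj_transpose U) ** U = A"
  using assms unfolding unitary_def by (metis matrix_mul_assoc matrix_mul_lid matrix_mul_rid)+

lemma det_conj_unitary:
  assumes "unitary U"
  shows "det (U ** A ** conj_transpose U) = det A"
proof -
  have "det U * det (conj_transpose U) = 1"
    using assms by (metis det_mul det_I unitary_def)
  then show ?thesis
    by (simp add: det_mul mult.commute mult.left_commute)
qed

lemma eigenvalue_vector_conj_unitary:
  fixes U :: "complex ^ 'n ^ 'n"
  assumes "unitary U"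
  shows "eigenvalue_vector (U ** A ** conj_transpose U) = eigenvalue_vector A"
proof -
  have "mat z - U ** A ** conj_transpose U = U ** (mat z - A) ** conj_transpose U" for z
  proof -
    have "U ** mat z = mat z ** U"
      by (simp add: vec_eq_iff matrix_matrix_mult_def mat_def if_distrib if_distribR
          sum.delta sum.delta' cong: if_cong)
    then have "U ** mat z ** conj_transpose U = mat z"
      using assms by (metis matrix_mul_assoc matrix_mul_rid unitary_def)
    moreover have "U ** (X - Y) ** Z = U ** X ** Z - U ** Y ** Z" for X Y Z :: "complex ^ 'n ^ 'n"
      by (simp add: vec_eq_iff matrix_matrix_mult_def sum_subtractf algebra_simps)
    ultimately show ?thesis
      by simp
  qed
  then show ?thesis
    using det_conj_unitary[OF assms] by (simp add: eigenvalue_vector_def fun_eq_iff)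
qed

corollary eigvals_conj_unitary:
  "unitary U \<Longrightarrow> eigvals (U ** A ** conj_transpose U) = eigvals A"
  by (simp add: eigvals_def eigenvalue_vector_conj_unitary)

definition diag_mat :: "real ^ 'n \<Rightarrow> complex ^ 'n ^ 'n" where
  "diag_mat l = (\<chi> i j. if i = j then complex_of_real (l $ i) else 0)"

definition rotated_diag :: "complex ^ 'n ^ 'n \<Rightarrow> real ^ 'n \<Rightarrow> complex ^ 'n ^ 'n" where
  "rotated_diag V l = V ** diag_mat l ** conj_transpose V"

lemma mult_diag_mat_nth: "(A ** diag_mat l) $ i $ j = A $ i $ j * complex_of_real (l $ j)"
  by (simp add: matrix_matrix_mult_def diag_mat_def if_distrib if_distribR cong: if_cong)

lemma diag_mat_mult_nth: "(diag_mat l ** A) $ i $ j = complex_of_real (l $ i) * A $ i $ j"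
  by (simp add: matrix_matrix_mult_def diag_mat_def if_distrib if_distribR cong: if_cong)

lemma rotated_diag_nth:
  "rotated_diag V l $ i $ j = (\<Sum>k\<in>UNIV. V $ i $ k * complex_of_real (l $ k) * cnj (V $ j $ k))"
  unfolding rotated_diag_def matrix_matrix_mult_def[of "V ** diag_mat l"]
  by (simp add: mult_diag_mat_nth conj_transpose_nth)

lemma hermitian_rotated_diag: "hermitian (rotated_diag V l)"
  by (simp add: hermitian_def vec_eq_iff conj_transpose_nth rotated_diag_nth algebra_simps)

lemma hermitian_conj: "hermitian A \<Longrightarrow> hermitian (U ** A ** conj_transpose U)"
  by (simp add: hermitian_def conj_transpose_mult matrix_mul_assoc)

lemma det_diag_mat: "det (diag_mat l) = complex_of_real (\<Prod>i\<in>UNIV. l $ i)"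
  by (subst det_diagonal) (auto simp: diag_mat_def)

lemma eigenvalue_vector_rotated_diag:
  assumes "unitary V"
  shows "eigenvalue_vector (rotated_diag V l) l"
proof -
  have "eigenvalue_vector (diag_mat l) l"
    unfolding eigenvalue_vector_def
    by (subst det_diagonal) (auto simp: diag_mat_def mat_def)
  then show ?thesis
    by (simp add: rotated_diag_def eigenvalue_vector_conj_unitary[OF assms])
qed

lemma inner_complex_mat:
  fixes X Y :: "complex ^ 'n ^ 'n"
  shows "X \<bullet> Y = Re (trace (conj_transpose X ** Y))"
proof -
  have "x \<bullet> y = Re (cnj x * y)" for x y :: complex
    by (simp add: inner_complex_def)
  then show ?thesis
    unfolding trace_def matrix_matrix_mult_def inner_vec_def
    by (simp add: conj_transpose_nth) (rule sum.swap)
qed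

lemma inner_conj_unitary:
  fixes X Y :: "complex ^ 'n ^ 'n"
  shows "(V ** X ** conj_transpose V) \<bullet> Y = X \<bullet> (conj_transpose V ** Y ** V)"
proof -
  have "trace (V ** conj_transpose X ** conj_transpose V ** Y)
      = trace (conj_transpose X ** conj_transpose V ** Y ** V)"
    using trace_mul_sym[of V "conj_transpose X ** conj_transpose V ** Y"]
    by (simp add: matrix_mul_assoc)
  then show ?thesis
    by (simp add: inner_complex_mat conj_transpose_mult matrix_mul_assoc)
qed

lemma inner_diag_mat:
  "diag_mat g \<bullet> Y = (\<Sum>i\<in>UNIV. g $ i * Re (Y $ i $ i))"
  unfolding inner_vec_def diag_mat_def
  by (simp add: if_distrib if_distribR inner_complex_def cong: if_cong)

lemma unitary_row_sum:
  assumes "unitary U"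
  shows "(\<Sum>j\<in>UNIV. (cmod (U $ i $ j))\<^sup>2) = 1"
proof -
  have "(U ** conj_transpose U) $ i $ i = 1"
    using assms by (simp add: unitary_def mat_def)
  then have "complex_of_real (\<Sum>j\<in>UNIV. (cmod (U $ i $ j))\<^sup>2) = 1"
    unfolding matrix_matrix_mult_def by (simp add: conj_transpose_nth complex_mult_cnj cmod_power2)
  then show ?thesis
    using of_real_eq_1_iff by blast
qed

lemma unitary_col_sum:
  assumes "unitary U"
  shows "(\<Sum>i\<in>UNIV. (cmod (U $ i $ j))\<^sup>2) = 1"
  using unitary_row_sum[OF unitary_conj_transpose[OF assms]] by (simp add: conj_transpose_nth)

lemma inner_rotated_diag:
  fixes V W :: "complex ^ 'n ^ 'n"
  shows "rotated_diag V g \<bullet> rotated_diag W b =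
    (\<Sum>i\<in>UNIV. \<Sum>j\<in>UNIV. g $ i * (cmod ((conj_transpose V ** W) $ i $ j))\<^sup>2 * b $ j)"
proof -
  define M where "M = conj_transpose V ** W"
  have "conj_transpose V ** rotated_diag W b ** V = rotated_diag M b"
    by (simp add: rotated_diag_def M_def conj_transpose_mult matrix_mul_assoc)
  then have "rotated_diag V g \<bullet> rotated_diag W b = diag_mat g \<bullet> rotated_diag M b"
    by (simp add: rotated_diag_def[of V] inner_conj_unitary)
  also have "Re (rotated_diag M b $ i $ i) = (\<Sum>j\<in>UNIV. (cmod (M $ i $ j))\<^sup>2 * b $ j)" for i
    unfolding rotated_diag_nth Re_sum
    by (intro sum.cong refl, simp add: cmod_power2) (simp add: power2_eq_square algebra_simps)
  then have "diag_mat g \<bullet> rotated_diag M b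
      = (\<Sum>i\<in>UNIV. \<Sum>j\<in>UNIV. g $ i * (cmod (M $ i $ j))\<^sup>2 * b $ j)"
    by (simp add: inner_diag_mat sum_distrib_left mult.assoc)
  finally show ?thesis
    by (simp add: M_def)
qed

section \<open>The spectral theorem for hermitian matrices\<close>

text \<open>A maximizer \<open>v\<close> of the Rayleigh quotient on the unit sphere of \<open>W\<close> is an eigenvector.  With the
  maximum \<open>c\<close>, the quadratic form \<open>q x = c (x \<bullet> x) - x \<bullet> L x\<close> is nonnegative on \<open>W\<close> and vanishes at
  \<open>v\<close>, so its first variation at \<open>v\<close> vanishes; this variation in the direction \<open>w = c v - L v\<close>, which
  belongs to \<open>W\<close>, is \<open>2 (w \<bullet> w)\<close>.\<close>

lemma self_adjoint_eigenvector:
  fixes L :: "'a::euclidean_space \<Rightarrow> 'a"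
  assumes L: "linear L" and sym: "\<And>x y. x \<bullet> L y = L x \<bullet> y"
    and W: "subspace W" and LW: "\<And>x. x \<in> W \<Longrightarrow> L x \<in> W" and x0: "x0 \<in> W" "x0 \<noteq> 0"
  obtains v c where "v \<in> W" "norm v = 1" "L v = c *\<^sub>R v"
proof -
  have "compact (W \<inter> sphere 0 1)"
    by (simp add: closed_Int_compact closed_subspace W)
  moreover have "x0 /\<^sub>R norm x0 \<in> W \<inter> sphere 0 1"
    using x0 by (simp add: subspace_scale[OF W])
  moreover have "continuous_on (W \<inter> sphere 0 1) (\<lambda>x. x \<bullet> L x)"
    using L by (intro continuous_intros linear_continuous_on) (simp add: linear_conv_bounded_linear)
  ultimately obtain v where v: "v \<in> W \<inter> sphere 0 1"
    and max: "\<And>x. x \<in> W \<inter> sphere 0 1 \<Longrightarrow> x \<bullet> L x \<le> v \<bullet> L v"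
    using continuous_attains_sup[of "W \<inter> sphere 0 1" "\<lambda>x. x \<bullet> L x"] by blast
  define c where "c = v \<bullet> L v"
  define q where "q x = c * (x \<bullet> x) - x \<bullet> L x" for x
  have q: "0 \<le> q x" if "x \<in> W" for x
  proof (cases "x = 0")
    case False
    have "x /\<^sub>R norm x \<in> W \<inter> sphere 0 1"
      using that False by (simp add: subspace_scale[OF W])
    from max[OF this] have "(x \<bullet> L x) / (norm x)\<^sup>2 \<le> c"
      by (simp add: c_def linear_scale[OF L] power2_eq_square divide_inverse mult_ac)
    then show ?thesis
      using False by (simp add: q_def field_simps dot_square_norm)
  qed (simp add: q_def linear_0[OF L])
  define w where "w = c *\<^sub>R v - L v"
  have w: "w \<in> W"
    unfolding w_def using v LW by (intro subspace_diff[OF W] subspace_scale[OF W]) auto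
  have vv: "v \<bullet> v = 1"
    using v by (simp add: dot_square_norm)
  have exp: "q (v + t *\<^sub>R w) = 2 * t * (w \<bullet> w) + t\<^sup>2 * q w" for t
  proof -
    have "v \<bullet> L w = w \<bullet> L v"
      by (metis sym inner_commute)
    then have "q (v + t *\<^sub>R w) = 2 * t * (c * (v \<bullet> w) - w \<bullet> L v) + t\<^sup>2 * q w"
      unfolding q_def using vv
      by (simp add: linear_add[OF L] linear_scale[OF L] inner_simps c_def power2_eq_square
          algebra_simps inner_commute)
    also have "c * (v \<bullet> w) - w \<bullet> L v = w \<bullet> w"
      by (simp add: w_def inner_simps inner_commute algebra_simps)
    finally show ?thesis .
  qed
  have "w \<bullet> w = 0"
  proof (rule ccontr)
    assume "w \<bullet> w \<noteq> 0"
    then have e: "0 < w \<bullet> w"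
      using inner_ge_zero[of w] by linarith
    \<comment> \<open>The step is negative and so short that the linear term of \<open>exp\<close> dominates.\<close>
    define t where "t = - (w \<bullet> w) / (q w + 1)"
    have "0 < q w + 1"
      using q[OF w] by simp
    then have t: "t < 0" and "t * (q w + 1) = - (w \<bullet> w)"
      unfolding t_def using e by (simp_all add: divide_neg_pos)
    then have "t * q w + t = - (w \<bullet> w)"
      by (simp add: algebra_simps)
    with t e have "0 < 2 * (w \<bullet> w) + t * q w"
      by linarith
    with t have "t * (2 * (w \<bullet> w) + t * q w) < 0"
      by (intro mult_neg_pos)
    moreover have "0 \<le> q (v + t *\<^sub>R w)"
      using v w by (intro q subspace_add[OF W] subspace_scale[OF W]) auto
    ultimately show False
      unfolding exp by (simp add: power2_eq_square algebra_simps)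
  qed
  then have "L v = c *\<^sub>R v"
    by (simp add: w_def)
  with v show ?thesis
    by (intro that[of v c]) auto
qed

definition cdot :: "complex ^ 'n \<Rightarrow> complex ^ 'n \<Rightarrow> complex" where
  "cdot x y = (\<Sum>i\<in>UNIV. cnj (x $ i) * y $ i)"

lemma inner_eq_Re_cdot: "x \<bullet> y = Re (cdot x y)"
  by (simp add: cdot_def inner_vec_def inner_complex_def)

lemma cdot_simps:
  "cdot x (y + z) = cdot x y + cdot x z" "cdot x (c *s y) = c * cdot x y"
  "cdot (c *s x) y = cnj c * cdot x y" "cdot x (r *\<^sub>R y) = of_real r * cdot x y" "cdot x 0 = 0"
  by (simp_all add: cdot_def sum.distrib sum_distrib_left algebra_simps)
    (simp_all add: scaleR_conv_of_real)

lemma cnj_cdot: "cnj (cdot x y) = cdot y x"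
  by (simp add: cdot_def mult.commute)

lemma cdot_self: "cdot x x = of_real ((norm x)\<^sup>2)"
proof -
  have "Im (cdot x x) = 0"
    using cnj_cdot[of x x] by (simp add: complex_eq_iff)
  then show ?thesis
    using inner_eq_Re_cdot[of x x] by (simp add: complex_eq_iff dot_square_norm)
qed

lemma cdot_hermitian:
  assumes "hermitian A"
  shows "cdot x (A *v y) = cdot (A *v x) y"
proof -
  have "cdot x (A *v y) = (\<Sum>i\<in>UNIV. \<Sum>j\<in>UNIV. cnj (x $ i) * A $ i $ j * y $ j)"
    by (simp add: cdot_def matrix_vector_mult_def sum_distrib_left mult.assoc)
  also have "\<dots> = (\<Sum>j\<in>UNIV. \<Sum>i\<in>UNIV. cnj (x $ i) * A $ i $ j * y $ j)"
    by (rule sum.swap)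
  also have "\<dots> = cdot (A *v x) y"
    by (simp add: cdot_def matrix_vector_mult_def sum_distrib_left sum_distrib_right
        hermitian_entry[OF assms] algebra_simps)
  finally show ?thesis .
qed

text \<open>An orthonormal family with fewer than \<open>n\<close> members leaves a nonzero orthogonal complement,
  which \<open>A\<close> maps to itself.  As a real space this complement carries a real symmetric map, so the
  Rayleigh quotient gives one more eigenvector.\<close>

lemma hermitian_orthonormal_eigenvectors:
  fixes A :: "complex ^ 'n ^ 'n" and I :: "'n set"
  assumes A: "hermitian A"
  shows "\<exists>v l. (\<forall>i\<in>I. A *v v i = of_real (l i) *s v i) \<and>
    (\<forall>i\<in>I. \<forall>j\<in>I. cdot (v i) (v j) = (if i = j then 1 else 0))"
  using finite[of I]
proof (induction I rule: finite_induct)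
  case empty
  then show ?case
    by simp
next
  case (insert k I)
  then obtain v l where ev: "\<And>i. i \<in> I \<Longrightarrow> A *v v i = of_real (l i) *s v i"
    and on: "\<And>i j. i \<in> I \<Longrightarrow> j \<in> I \<Longrightarrow> cdot (v i) (v j) = (if i = j then 1 else 0)"
    by metis
  define W where "W = {w. \<forall>i\<in>I. cdot (v i) w = 0}"
  have W: "subspace W"
    by (auto simp: W_def subspace_def cdot_simps)
  have AW: "A *v w \<in> W" if "w \<in> W" for w
    using that by (simp add: W_def cdot_hermitian[OF A] ev cdot_simps)
  define S where "S = v ` I \<union> (\<lambda>i. \<i> *s v i) ` I"
  have "card S \<le> card I + card I"
    unfolding S_def
    by (meson add_mono card_Un_le card_image_le insert.hyps(1) le_trans)
  also have "\<dots> < 2 * CARD('n)"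
  proof -
    have "I \<subset> UNIV"
      using insert.hyps(2) by auto
    then show ?thesis
      using psubset_card_mono[of "UNIV :: 'n set" I] by simp
  qed
  finally have "dim S < DIM(complex ^ 'n)"
    using dim_le_card'[of S] insert.hyps(1) by (simp add: S_def)
  then obtain x where x: "x \<noteq> 0" "\<And>y. y \<in> span S \<Longrightarrow> orthogonal x y"
    using orthogonal_to_subspace_exists by blast
  have "cdot (v i) x = 0" if "i \<in> I" for i
  proof -
    have "v i \<bullet> x = 0" "(\<i> *s v i) \<bullet> x = 0"
      using x(2)[OF span_base, of "v i"] x(2)[OF span_base, of "\<i> *s v i"] that
      by (simp_all add: S_def orthogonal_def inner_commute[of x])
    then show ?thesis
      by (simp add: inner_eq_Re_cdot cdot_simps complex_eq_iff)
  qed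
  then have "x \<in> W"
    by (simp add: W_def)
  moreover have "linear ((*v) A)"
    by (rule linearI, rule matrix_vector_right_distrib)
      (simp add: vec_eq_iff matrix_vector_mult_def scaleR_sum_right)
  moreover have "x \<bullet> (A *v y) = (A *v x) \<bullet> y" for x y
    by (simp add: inner_eq_Re_cdot cdot_hermitian[OF A])
  ultimately obtain u c where u: "u \<in> W" "norm u = 1" "A *v u = c *\<^sub>R u"
    using self_adjoint_eigenvector[of "(*v) A" W x] W AW x(1) by blast
  have "c *\<^sub>R u = of_real c *s u"
    by (simp add: vec_eq_iff) (simp add: scaleR_conv_of_real)
  moreover have "cdot (v i) u = 0" "cdot u (v i) = 0" if "i \<in> I" for i
    using u(1) that cnj_cdot[of "v i" u] by (auto simp: W_def)
  moreover have "cdot u u = 1"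
    by (simp add: cdot_self u(2))
  ultimately show ?case
    using u(3) ev on insert.hyps(2)
    by (intro exI[of _ "v(k := u)"] exI[of _ "l(k := c)"]) auto
qed

lemma hermitian_diagonalizable:
  fixes A :: "complex ^ 'n ^ 'n"
  assumes A: "hermitian A"
  obtains V l where "unitary V" "A = rotated_diag V l"
proof -
  obtain v :: "'n \<Rightarrow> complex ^ 'n" and l where "\<forall>i\<in>(UNIV :: 'n set). A *v v i = of_real (l i) *s v i"
    and "\<forall>i\<in>UNIV. \<forall>j\<in>UNIV. cdot (v i) (v j) = (if i = j then 1 else 0)"
    using hermitian_orthonormal_eigenvectors[OF A, of UNIV] by blast
  then have ev: "\<And>i. A *v v i = of_real (l i) *s v i"
    and on: "\<And>i j. cdot (v i) (v j) = (if i = j then 1 else 0)"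
    by simp_all
  define V :: "complex ^ 'n ^ 'n" where "V = (\<chi> i j. v j $ i)"
  have VV: "conj_transpose V ** V = mat 1"
    using on by (simp add: vec_eq_iff matrix_matrix_mult_def conj_transpose_nth V_def cdot_def mat_def)
  then have U: "unitary V"
    using matrix_left_right_inverse by (auto simp: unitary_def)
  have "(A ** V) $ i $ j = (V ** diag_mat (\<chi> i. l i)) $ i $ j" for i j
  proof -
    have "(A ** V) $ i $ j = (A *v v j) $ i"
      by (simp add: matrix_matrix_mult_def matrix_vector_mult_def V_def)
    then show ?thesis
      by (simp add: ev mult_diag_mat_nth) (simp add: V_def)
  qed
  then have "A ** V = V ** diag_mat (\<chi> i. l i)"
    by (simp add: vec_eq_iff)
  then have "A = rotated_diag V (\<chi> i. l i)"
    unfolding rotated_diag_def using unitary_cancel(3)[OF U, of A] by simp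
  with U show ?thesis
    by (rule that)
qed

text \<open>Both vectors list the roots, with multiplicity, of the same polynomial.\<close>

lemma eigenvalue_vector_unique:
  fixes a b :: "real ^ 'n"
  assumes "eigenvalue_vector A a" and "eigenvalue_vector A b"
  obtains p where "p permutes UNIV" "b = (\<chi> i. a $ p i)"
proof -
  define P :: "real ^ 'n \<Rightarrow> complex poly" where
    "P l = (\<Prod>i\<in>UNIV. [:- complex_of_real (l $ i), 1:])" for l
  have "poly (P l) z = (\<Prod>i\<in>UNIV. z - complex_of_real (l $ i))" for l z
    by (simp add: P_def poly_prod)
  then have "poly (P a) = poly (P b)"
    using assms by (simp add: eigenvalue_vector_def fun_eq_iff)
  then have eq: "P a = P b"
    by (rule iffD1[OF poly_eq_poly_eq_iff])
  have "proots (P l) = image_mset (\<lambda>i. complex_of_real (l $ i)) (mset_set UNIV)" for l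
  proof -
    have "(\<Sum>i\<in>S. {#complex_of_real (l $ i)#}) = image_mset (\<lambda>i. complex_of_real (l $ i)) (mset_set S)"
      for S :: "'n set"
      using finite[of S] by (induction S rule: finite_induct) auto
    then show ?thesis
      by (simp add: P_def proots_prod)
  qed
  then have "image_mset (\<lambda>i. complex_of_real (b $ i)) (mset_set UNIV)
      = image_mset (\<lambda>i. complex_of_real (a $ i)) (mset_set UNIV)"
    by (metis eq)
  then obtain p where "p permutes UNIV" "\<forall>i\<in>UNIV. complex_of_real (b $ i) = complex_of_real (a $ p i)"
    by (rule image_mset_eq_implies_permutes[rotated]) auto
  then show ?thesis
    by (intro that[of p]) (auto simp: vec_eq_iff)
qed

text \<open>Permuting the columns of the unitary matrix realizes every order of the eigenvalues, in
  particular the unspecified one of \<open>eigvals\<close>.\<close>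

lemma rotated_diag_permute:
  assumes p: "p permutes UNIV" and V: "unitary V"
  shows "unitary (\<chi> i j. V $ i $ p j)"
    and "rotated_diag (\<chi> i j. V $ i $ p j) (\<chi> i. l $ p i) = rotated_diag V l"
proof -
  let ?V = "\<chi> i j. V $ i $ p j"
  have "(conj_transpose ?V ** ?V) $ i $ j = (conj_transpose V ** V) $ p i $ p j" for i j
    by (simp add: matrix_matrix_mult_def conj_transpose_nth)
  also have "(conj_transpose V ** V) $ p i $ p j = mat 1 $ i $ j" for i j
    using V permutes_inj[OF p] by (simp add: unitary_def mat_def inj_eq)
  finally have "conj_transpose ?V ** ?V = mat 1"
    by (simp add: vec_eq_iff)
  then show "unitary ?V"
    using matrix_left_right_inverse by (auto simp: unitary_def)
  have "(\<Sum>k\<in>UNIV. V $ i $ p k * complex_of_real (l $ p k) * cnj (V $ j $ p k))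
      = (\<Sum>k\<in>UNIV. V $ i $ k * complex_of_real (l $ k) * cnj (V $ j $ k))" for i j
    using sum.permute[OF p, of "\<lambda>k. V $ i $ k * complex_of_real (l $ k) * cnj (V $ j $ k)"]
    by (simp add: o_def)
  then show "rotated_diag ?V (\<chi> i. l $ p i) = rotated_diag V l"
    by (simp add: vec_eq_iff rotated_diag_nth)
qed

lemma eigenvalue_vector_eigvals:
  assumes "hermitian A"
  shows "eigenvalue_vector A (eigvals A)"
  unfolding eigvals_def
  by (rule hermitian_diagonalizable[OF assms])
    (auto intro: someI eigenvalue_vector_rotated_diag)

lemma hermitian_eq_rotated_eigvals:
  assumes A: "hermitian A"
  obtains V where "unitary V" "A = rotated_diag V (eigvals A)"
proof -
  obtain W l where W: "unitary W" "A = rotated_diag W l"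
    using hermitian_diagonalizable[OF A] .
  then have "eigenvalue_vector A l"
    by (simp add: eigenvalue_vector_rotated_diag)
  then obtain p where p: "p permutes UNIV" "eigvals A = (\<chi> i. l $ p i)"
    by (rule eigenvalue_vector_unique[OF _ eigenvalue_vector_eigvals[OF A]])
  show ?thesis
    using that[OF rotated_diag_permute(1)[OF p(1) W(1)]] rotated_diag_permute(2)[OF p(1) W(1), of l]
      p(2) W(2) by simp
qed

section \<open>A rearrangement inequality for doubly stochastic matrices\<close>

text \<open>Layer-cake formula: \<open>g i - m\<close> is the integral over \<open>t \<ge> m\<close> of the indicator of \<open>t \<le> g i\<close>, so the
  weighted sum is an integral of the sums over upper level sets.\<close>

lemma weighted_sum_nonneg_of_upper_level_sums:
  fixes g x :: "'n::finite \<Rightarrow> real"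
  assumes total: "(\<Sum>i\<in>UNIV. x i) = 0" and upper: "\<And>t. 0 \<le> (\<Sum>i | t \<le> g i. x i)"
  shows "0 \<le> (\<Sum>i\<in>UNIV. g i * x i)"
proof -
  define m where "m = Min (range g)"
  define M where "M = Max (range g)"
  have mM: "m \<le> g i" "g i \<le> M" for i
    by (auto simp: m_def M_def)
  have "((\<lambda>t. if t \<in> {m..g i} then 1 else 0) has_integral (g i - m)) {m..M}" for i
    using has_integral_const_real[of "1 :: real" m "g i"] mM
    by (subst has_integral_restrict) (auto simp: max_def)
  then have "((\<lambda>t. \<Sum>i\<in>UNIV. x i * (if t \<in> {m..g i} then 1 else 0))
      has_integral (\<Sum>i\<in>UNIV. x i * (g i - m))) {m..M}"
    by (intro has_integral_sum has_integral_mult_right) auto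
  moreover have "(\<Sum>i\<in>UNIV. x i * (if t \<in> {m..g i} then 1 else 0)) = (\<Sum>i | t \<le> g i. x i)"
    if "t \<in> {m..M}" for t
    using that by (simp add: sum.If_cases if_distrib cong: if_cong)
  ultimately have "0 \<le> (\<Sum>i\<in>UNIV. x i * (g i - m))"
    using upper by (elim has_integral_nonneg) simp
  also have "\<dots> = (\<Sum>i\<in>UNIV. g i * x i) - m * (\<Sum>i\<in>UNIV. x i)"
    by (simp add: algebra_simps sum_subtractf sum_distrib_left)
  finally show ?thesis
    using total by simp
qed

text \<open>A permutation \<open>\<sigma>\<close> that minimizes the left-hand side pairs large \<open>g\<close> with small \<open>b\<close>, since
  otherwise exchanging two of its values would decrease the sum.  Hence on an upper level set of \<open>g\<close>
  with \<open>k\<close> elements it collects the \<open>k\<close> smallest entries of \<open>b\<close>, and averaging \<open>b\<close> with weights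
  between \<open>0\<close> and \<open>1\<close> of total mass \<open>k\<close> cannot give less.\<close>

lemma doubly_stochastic_rearrangement:
  fixes S :: "'n::finite \<Rightarrow> 'n \<Rightarrow> real" and g b :: "'n \<Rightarrow> real"
  assumes nonneg: "\<And>i j. 0 \<le> S i j"
    and rows: "\<And>i. (\<Sum>j\<in>UNIV. S i j) = 1" and cols: "\<And>j. (\<Sum>i\<in>UNIV. S i j) = 1"
  obtains \<sigma> where "\<sigma> permutes UNIV"
    and "(\<Sum>i\<in>UNIV. g i * b (\<sigma> i)) \<le> (\<Sum>i\<in>UNIV. \<Sum>j\<in>UNIV. g i * S i j * b j)"
proof -
  define E where "E \<sigma> = (\<Sum>i\<in>UNIV. g i * b (\<sigma> i))" for \<sigma> :: "'n \<Rightarrow> 'n"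
  have "finite {\<sigma>. \<sigma> permutes (UNIV :: 'n set)}" "{\<sigma>. \<sigma> permutes (UNIV :: 'n set)} \<noteq> {}"
    using permutes_id by (simp add: finite_permutations, blast)
  then obtain \<sigma> where \<sigma>: "\<sigma> permutes UNIV" and min: "\<And>\<tau>. \<tau> permutes UNIV \<Longrightarrow> E \<sigma> \<le> E \<tau>"
    using ex_is_arg_min_if_finite[of "{\<sigma>. \<sigma> permutes (UNIV :: 'n set)}" E]
    by (auto simp: is_arg_min_linorder)
  have opposite: "b (\<sigma> i) \<le> b (\<sigma> j)" if "g j < g i" for i j
  proof -
    have ij: "i \<noteq> j"
      using that by auto
    define \<tau> where "\<tau> = \<sigma> \<circ> Transposition.transpose i j"
    have "\<tau> permutes UNIV"
      unfolding \<tau>_def using \<sigma> by (intro permutes_compose permutes_swap_id) auto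
    from min[OF this] have "0 \<le> (\<Sum>k\<in>UNIV. g k * (b (\<tau> k) - b (\<sigma> k)))"
      by (simp add: E_def algebra_simps sum_subtractf)
    also have "\<dots> = (\<Sum>k\<in>{i, j}. g k * (b (\<tau> k) - b (\<sigma> k)))"
      by (rule sum.mono_neutral_right) (auto simp: \<tau>_def transpose_apply_other)
    also have "\<dots> = (g i - g j) * (b (\<sigma> j) - b (\<sigma> i))"
      using ij by (simp add: \<tau>_def algebra_simps)
    finally show ?thesis
      using that by (simp add: zero_le_mult_iff)
  qed
  define x where "x i = (\<Sum>j\<in>UNIV. S i j * b j) - b (\<sigma> i)" for i
  have reindex: "(\<Sum>j\<in>UNIV. f (\<sigma> j)) = (\<Sum>j\<in>UNIV. f j)" for f :: "'n \<Rightarrow> real"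
    using sum.permute[OF \<sigma>, of f] by (simp add: o_def)
  have total: "(\<Sum>i\<in>UNIV. x i) = 0"
  proof -
    have "(\<Sum>i\<in>UNIV. \<Sum>j\<in>UNIV. S i j * b j) = (\<Sum>j\<in>UNIV. (\<Sum>i\<in>UNIV. S i j) * b j)"
      by (subst sum.swap) (simp add: sum_distrib_right)
    then show ?thesis
      by (simp add: x_def sum_subtractf cols reindex)
  qed
  have upper: "0 \<le> (\<Sum>i | t \<le> g i. x i)" for t
  proof (cases "{i. t \<le> g i} = {}")
    case False
    define T where "T = {i. t \<le> g i}"
    define \<theta> where "\<theta> = Max ((\<lambda>i. b (\<sigma> i)) ` T)"
    have below: "b (\<sigma> i) \<le> \<theta>" if "i \<in> T" for i
      using that by (simp add: \<theta>_def)
    have above: "\<theta> \<le> b (\<sigma> j)" if "j \<notin> T" for j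
      using that False opposite by (force simp: \<theta>_def T_def)
    define w where "w j = (\<Sum>i\<in>T. S i (\<sigma> j))" for j
    have w: "0 \<le> w j" "w j \<le> 1" for j
    proof -
      show "0 \<le> w j"
        by (simp add: w_def nonneg sum_nonneg)
      have "w j \<le> (\<Sum>i\<in>UNIV. S i (\<sigma> j))"
        unfolding w_def by (rule sum_mono2) (auto simp: nonneg)
      then show "w j \<le> 1"
        by (simp add: cols)
    qed
    have "(\<Sum>j\<in>UNIV. w j) = (\<Sum>i\<in>T. \<Sum>j\<in>UNIV. S i (\<sigma> j))"
      unfolding w_def by (rule sum.swap)
    also have "\<dots> = (\<Sum>j\<in>UNIV. if j \<in> T then 1 else 0)"
      by (simp add: reindex[of "S _"] rows sum.If_cases)
    finally have mass: "(\<Sum>j\<in>UNIV. w j) = (\<Sum>j\<in>UNIV. if j \<in> T then 1 else 0)" .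
    have "(\<Sum>i\<in>T. x i) = (\<Sum>i\<in>T. \<Sum>j\<in>UNIV. S i (\<sigma> j) * b (\<sigma> j)) - (\<Sum>i\<in>T. b (\<sigma> i))"
      by (simp add: x_def sum_subtractf reindex[of "\<lambda>j. S _ j * b j"])
    also have "(\<Sum>i\<in>T. \<Sum>j\<in>UNIV. S i (\<sigma> j) * b (\<sigma> j)) = (\<Sum>j\<in>UNIV. w j * b (\<sigma> j))"
      unfolding w_def by (subst sum.swap) (simp add: sum_distrib_right)
    also have "(\<Sum>i\<in>T. b (\<sigma> i)) = (\<Sum>j\<in>UNIV. (if j \<in> T then 1 else 0) * b (\<sigma> j))"
      by (simp add: sum.If_cases if_distribR if_distrib cong: if_cong)
    also have "(\<Sum>j\<in>UNIV. w j * b (\<sigma> j)) - (\<Sum>j\<in>UNIV. (if j \<in> T then 1 else 0) * b (\<sigma> j))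
        = (\<Sum>j\<in>UNIV. (w j - (if j \<in> T then 1 else 0)) * (b (\<sigma> j) - \<theta>))
          + \<theta> * ((\<Sum>j\<in>UNIV. w j) - (\<Sum>j\<in>UNIV. if j \<in> T then 1 else 0))"
      by (simp only: left_diff_distrib right_diff_distrib sum_subtractf sum_distrib_left
          mult.commute[of _ \<theta>])
    also have "\<dots> = (\<Sum>j\<in>UNIV. (w j - (if j \<in> T then 1 else 0)) * (b (\<sigma> j) - \<theta>))"
      by (simp add: mass)
    also have "\<dots> \<ge> 0"
    proof (rule sum_nonneg)
      fix j
      show "0 \<le> (w j - (if j \<in> T then 1 else 0)) * (b (\<sigma> j) - \<theta>)"
        using w[of j] below[of j] above[of j] by (simp add: zero_le_mult_iff)
    qed
    finally show ?thesis
      by (simp add: T_def)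
  qed (simp only: sum.empty)
  have "0 \<le> (\<Sum>i\<in>UNIV. g i * x i)"
    by (rule weighted_sum_nonneg_of_upper_level_sums[OF total upper])
  then have "(\<Sum>i\<in>UNIV. g i * b (\<sigma> i)) \<le> (\<Sum>i\<in>UNIV. \<Sum>j\<in>UNIV. g i * S i j * b j)"
    by (simp add: x_def right_diff_distrib sum_subtractf sum_distrib_left mult.assoc)
  with \<sigma> show ?thesis
    by (rule that)
qed

section \<open>Spectral functions of symmetric concave functions\<close>

locale symmetric_concave =
  fixes \<Gamma> :: "(real ^ 'n) set" and h :: "real ^ 'n \<Rightarrow> real" and g :: "real ^ 'n \<Rightarrow> real ^ 'n"
  assumes open_dom: "open \<Gamma>" and sym_dom: "symmetric_set \<Gamma>"
    and sym: "symmetric_on \<Gamma> h" and concave: "concave_on \<Gamma> h"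
    and deriv: "\<And>x. x \<in> \<Gamma> \<Longrightarrow> (h has_derivative (\<lambda>v. g x \<bullet> v)) (at x)"
    and cont_grad: "continuous_on \<Gamma> g"
begin

lemma below_tangent:
  assumes x: "x \<in> \<Gamma>" and y: "y \<in> \<Gamma>"
  shows "h y \<le> h x + g x \<bullet> (y - x)"
proof -
  define u :: "real \<Rightarrow> real" where "u = (\<lambda>t. h (x + t *\<^sub>R (y - x)))"
  have "((\<lambda>t. x + t *\<^sub>R (y - x)) has_derivative (\<lambda>t. t *\<^sub>R (y - x))) (at 0)"
    by (auto intro!: derivative_eq_intros)
  from has_derivative_compose[OF this, of h "\<lambda>v. g x \<bullet> v"] deriv[OF x]
  have "(u has_real_derivative g x \<bullet> (y - x)) (at 0)"
    by (simp add: u_def has_field_derivative_def mult_commute_abs)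
  then have lim: "((\<lambda>t. (u t - u 0) / t) \<longlongrightarrow> g x \<bullet> (y - x)) (at_right 0)"
    by (auto simp: has_field_derivative_iff intro: tendsto_within_subset)
  have "eventually (\<lambda>t. h y - h x \<le> (u t - u 0) / t) (at_right 0)"
    unfolding eventually_at_right_field
  proof (intro exI[of _ 1] conjI allI impI)
    fix t :: real
    assume t: "0 < t" "t < 1"
    have "(1 - t) * h x + t * h y \<le> h ((1 - t) *\<^sub>R x + t *\<^sub>R y)"
      using concave x y t by (auto simp: concave_on_iff)
    also have "(1 - t) *\<^sub>R x + t *\<^sub>R y = x + t *\<^sub>R (y - x)"
      by (simp add: algebra_simps)
    finally show "h y - h x \<le> (u t - u 0) / t"
      using t by (simp add: u_def field_simps)
  qed simp
  from tendsto_lowerbound[OF lim this] show ?thesis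
    by simp
qed

lemma permuted_in_dom: "x \<in> \<Gamma> \<Longrightarrow> p permutes UNIV \<Longrightarrow> (\<chi> i. x $ p i) \<in> \<Gamma>"
  using sym_dom by (simp add: symmetric_set_def)

text \<open>Differentiate \<open>h (P v) = h v\<close>, where \<open>P\<close> permutes the coordinates.\<close>

lemma grad_permute:
  assumes x: "x \<in> \<Gamma>" and p: "p permutes UNIV"
  shows "g (\<chi> i. x $ p i) $ i = g x $ p i"
proof -
  let ?P = "\<lambda>v :: real ^ 'n. (\<chi> i. v $ p i) :: real ^ 'n"
  have lin: "bounded_linear ?P"
    by (subst linear_conv_bounded_linear[symmetric]) (rule linearI; simp add: vec_eq_iff)
  have "((\<lambda>v. h (?P v)) has_derivative (\<lambda>v. g (?P x) \<bullet> ?P v)) (at x)"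
    using has_derivative_compose[OF bounded_linear_imp_has_derivative[OF lin]
        deriv[OF permuted_in_dom[OF x p]]] .
  moreover have "((\<lambda>v. h (?P v)) has_derivative (\<lambda>v. g x \<bullet> v)) (at x)"
    using sym p by (intro has_derivative_transform_within_open[OF deriv[OF x] open_dom x])
      (simp add: symmetric_on_def)
  ultimately have eq: "(\<lambda>v. g (?P x) \<bullet> ?P v) = (\<lambda>v. g x \<bullet> v)"
    by (rule has_derivative_unique)
  have "?P (axis (p i) 1) = axis i 1"
    using permutes_inj[OF p] by (auto simp: vec_eq_iff axis_def inj_eq)
  then show ?thesis
    using fun_cong[OF eq, of "axis (p i) 1"] by (simp add: inner_axis)
qed

text \<open>Composing \<open>p\<close> with a transposition of two equal entries of \<open>a\<close> does not change \<open>b\<close>, so one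
  may assume that the permutation takes \<open>i\<close> to \<open>j\<close>.\<close>

lemma grad_eq_of_entry_eq:
  assumes a: "a \<in> \<Gamma>" and p: "p permutes UNIV" and b: "b = (\<chi> i. a $ p i)"
    and eq: "a $ j = b $ i"
  shows "g b $ i = g a $ j"
proof -
  define q where "q = Transposition.transpose (p i) j \<circ> p"
  have q: "q permutes UNIV"
    unfolding q_def using p by (intro permutes_compose permutes_swap_id) auto
  have "a $ p i = a $ j"
    using eq by (simp add: b)
  then have "a $ Transposition.transpose (p i) j k = a $ k" for k
    by (simp add: Transposition.transpose_def)
  then have "b = (\<chi> k. a $ q k)"
    by (simp add: b q_def)
  then show ?thesis
    using grad_permute[OF a q, of i] by (simp add: q_def)
qed

text \<open>The matrix \<open>V diag(g a) V\<^sup>*\<close> depends only on \<open>V diag(a) V\<^sup>*\<close>: if \<open>M\<close> intertwines the two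
  diagonal matrices, then \<open>M\<close> has an entry at \<open>(i, j)\<close> only where the eigenvalues agree, and there the
  gradients agree as well.\<close>

lemma rotated_grad_unique:
  assumes V: "unitary V" and W: "unitary W" and eq: "rotated_diag V a = rotated_diag W b"
    and a: "a \<in> \<Gamma>" and p: "p permutes UNIV" and b: "b = (\<chi> i. a $ p i)"
  shows "rotated_diag V (g a) = rotated_diag W (g b)"
proof -
  define M where "M = conj_transpose W ** V"
  have intertwine: "M ** diag_mat c = conj_transpose W ** rotated_diag V c ** V"
    "diag_mat d ** M = conj_transpose W ** rotated_diag W d ** V" for c d
    by (simp_all add: M_def rotated_diag_def matrix_mul_assoc[symmetric] unitary_cancel V W)
      (use V in \<open>simp add: unitary_def\<close>)
  have "M $ i $ j * (complex_of_real (a $ j) - complex_of_real (b $ i)) = 0" for i j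
  proof -
    have "(M ** diag_mat a) $ i $ j = (diag_mat b ** M) $ i $ j"
      by (simp add: intertwine eq)
    then show ?thesis
      by (simp add: mult_diag_mat_nth diag_mat_mult_nth algebra_simps)
  qed
  then have "M $ i $ j = 0 \<or> g b $ i = g a $ j" for i j
    using grad_eq_of_entry_eq[OF a p b] by fastforce
  then have "(M ** diag_mat (g a)) $ i $ j = (diag_mat (g b) ** M) $ i $ j" for i j
    by (metis mult.commute mult_diag_mat_nth diag_mat_mult_nth mult_zero_left)
  then have "conj_transpose W ** rotated_diag V (g a) ** V
      = conj_transpose W ** rotated_diag W (g b) ** V"
    by (simp add: intertwine[symmetric] vec_eq_iff)
  then have "W ** (conj_transpose W ** rotated_diag V (g a) ** V) ** conj_transpose V
      = W ** (conj_transpose W ** rotated_diag W (g b) ** V) ** conj_transpose V"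
    by simp
  then show ?thesis
    by (simp add: matrix_mul_assoc[symmetric] unitary_cancel[OF W])
      (use V in \<open>simp add: unitary_def\<close>)
qed

text \<open>In an eigenbasis of the first matrix, the diagonal of the second one is \<open>S b\<close> with the doubly
  stochastic matrix \<open>S\<close> of the numbers \<open>|(V\<^sup>* W)\<^sub>i\<^sub>j|\<^sup>2\<close>.  By the rearrangement inequality the slope
  in the direction of \<open>S b\<close> is at least the slope in the direction of some permutation of \<open>b\<close>, where
  \<open>h\<close> has the same value as at \<open>b\<close>; there concavity of \<open>h\<close> applies.\<close>

lemma spectral_below_tangent:
  assumes V: "unitary V" and W: "unitary W" and a: "a \<in> \<Gamma>" and b: "b \<in> \<Gamma>"
  shows "h b \<le> h a + rotated_diag V (g a) \<bullet> (rotated_diag W b - rotated_diag V a)"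
proof -
  define M where "M = conj_transpose V ** W"
  have M: "unitary M"
    unfolding M_def by (intro unitary_mult unitary_conj_transpose V W)
  obtain \<sigma> where \<sigma>: "\<sigma> permutes UNIV"
    and le: "(\<Sum>i\<in>UNIV. g a $ i * b $ \<sigma> i)
      \<le> (\<Sum>i\<in>UNIV. \<Sum>j\<in>UNIV. g a $ i * (cmod (M $ i $ j))\<^sup>2 * b $ j)"
    by (rule doubly_stochastic_rearrangement[of "\<lambda>i j. (cmod (M $ i $ j))\<^sup>2" "\<lambda>i. g a $ i" "\<lambda>i. b $ i"])
      (use unitary_row_sum[OF M] unitary_col_sum[OF M] in auto)
  have "h b = h (\<chi> i. b $ \<sigma> i)"
    using sym b \<sigma> by (simp add: symmetric_on_def)
  also have "\<dots> \<le> h a + g a \<bullet> ((\<chi> i. b $ \<sigma> i) - a)"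
    by (rule below_tangent[OF a permuted_in_dom[OF b \<sigma>]])
  also have "g a \<bullet> (\<chi> i. b $ \<sigma> i) \<le> rotated_diag V (g a) \<bullet> rotated_diag W b"
    using le unfolding inner_rotated_diag by (simp add: M_def inner_vec_def)
  then have "h a + g a \<bullet> ((\<chi> i. b $ \<sigma> i) - a)
      \<le> h a + rotated_diag V (g a) \<bullet> rotated_diag W b - g a \<bullet> a"
    by (simp add: inner_diff_right)
  also have "g a \<bullet> a = rotated_diag V (g a) \<bullet> rotated_diag V a"
  proof -
    have "conj_transpose V ** V = mat 1"
      using V by (simp add: unitary_def)
    then show ?thesis
      unfolding inner_rotated_diag
      by (simp add: mat_def inner_vec_def if_distrib if_distribR cong: if_cong)
  qed
  finally show ?thesis
    by (simp add: inner_diff_right)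
qed

end

lemma tendsto_matrix_mult:
  fixes A :: "'a \<Rightarrow> complex ^ 'n ^ 'm" and B :: "'a \<Rightarrow> complex ^ 'k ^ 'n"
  assumes "(A \<longlongrightarrow> A0) F" and "(B \<longlongrightarrow> B0) F"
  shows "((\<lambda>x. A x ** B x) \<longlongrightarrow> A0 ** B0) F"
  by (intro vec_tendstoI) (auto simp: matrix_matrix_mult_def intro!: tendsto_intros assms)

lemma tendsto_conj_transpose:
  fixes A :: "'a \<Rightarrow> complex ^ 'n ^ 'm"
  assumes "(A \<longlongrightarrow> A0) F"
  shows "((\<lambda>x. conj_transpose (A x)) \<longlongrightarrow> conj_transpose A0) F"
  by (intro vec_tendstoI) (auto simp: conj_transpose_nth intro!: tendsto_intros assms)

lemma tendsto_diag_mat: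
  assumes "(l \<longlongrightarrow> l0) F"
  shows "((\<lambda>x. diag_mat (l x)) \<longlongrightarrow> diag_mat l0) F"
  by (intro vec_tendstoI) (auto simp: diag_mat_def intro!: tendsto_intros assms)

lemma compact_unitary: "compact {U :: complex ^ 'n ^ 'n. unitary U}"
proof -
  have "norm U \<le> sqrt CARD('n)" if "unitary U" for U :: "complex ^ 'n ^ 'n"
  proof -
    have "(norm U)\<^sup>2 = (\<Sum>i\<in>UNIV. \<Sum>j\<in>UNIV. (cmod (U $ i $ j))\<^sup>2)"
      by (simp add: power2_norm_eq_inner inner_vec_def)
    also have "\<dots> = CARD('n)"
      by (simp add: unitary_row_sum[OF that])
    finally show ?thesis
      by (simp add: real_le_rsqrt)
  qed
  then have "bounded {U :: complex ^ 'n ^ 'n. unitary U}"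
    by (auto simp: bounded_iff)
  moreover have "closed {U :: complex ^ 'n ^ 'n. unitary U}"
    unfolding closed_sequential_limits
  proof (intro allI impI, elim conjE)
    fix U :: "nat \<Rightarrow> complex ^ 'n ^ 'n" and U0
    assume U: "\<forall>n. U n \<in> {U. unitary U}" and lim: "U \<longlonglongrightarrow> U0"
    have "(\<lambda>n. conj_transpose (U n) ** U n) \<longlonglongrightarrow> conj_transpose U0 ** U0"
      by (intro tendsto_matrix_mult tendsto_conj_transpose lim)
    moreover have "(\<lambda>n. conj_transpose (U n) ** U n) = (\<lambda>n. mat 1)"
      using U by (auto simp: unitary_def)
    ultimately have "conj_transpose U0 ** U0 = mat 1"
      using LIMSEQ_unique[OF _ tendsto_const] by metis
    then show "U0 \<in> {U. unitary U}"
      using matrix_left_right_inverse by (auto simp: unitary_def)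
  qed
  ultimately show ?thesis
    by (simp add: compact_eq_bounded_closed)
qed

text \<open>The diagonalizing unitary matrices need not converge along with the hermitian matrices, but
  by compactness a subsequence does, and any limit diagonalizes the limit matrix.\<close>

lemma rotated_diag_convergent_subsequence:
  fixes B :: "nat \<Rightarrow> complex ^ 'n ^ 'n"
  assumes lim: "B \<longlonglongrightarrow> A" and B: "\<And>k. B k = rotated_diag (V k) (b k)"
    and V: "\<And>k. unitary (V k)"
  obtains r W a where "strict_mono r" "(V \<circ> r) \<longlonglongrightarrow> W" "unitary W" "(b \<circ> r) \<longlonglongrightarrow> a" "A = rotated_diag W a"
proof -
  obtain W r where r: "strict_mono (r :: nat \<Rightarrow> nat)" and W: "unitary W" and VW: "(V \<circ> r) \<longlonglongrightarrow> W"
    using compact_unitary[unfolded compact_eq_seq_compact_metric seq_compact_def] V by blast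
  define D where "D = conj_transpose W ** A ** W"
  have "(\<lambda>k. conj_transpose (V (r k)) ** B (r k) ** V (r k)) \<longlonglongrightarrow> D"
    unfolding D_def using VW LIMSEQ_subseq_LIMSEQ[OF lim r]
    by (intro tendsto_matrix_mult tendsto_conj_transpose) (simp_all add: o_def)
  moreover have "conj_transpose (V k) ** B k ** V k = diag_mat (b k)" for k
    using unitary_cancel(1,4)[OF V[of k]] by (simp add: B rotated_diag_def matrix_mul_assoc[symmetric])
  ultimately have D: "(\<lambda>k. diag_mat (b (r k))) \<longlonglongrightarrow> D"
    by simp
  define a where "a = (\<chi> i. Re (D $ i $ i))"
  have a: "(b \<circ> r) \<longlonglongrightarrow> a"
  proof (rule vec_tendstoI)
    fix i
    have "(\<lambda>k. Re (diag_mat (b (r k)) $ i $ i)) \<longlonglongrightarrow> Re (D $ i $ i)"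
      by (intro tendsto_intros D)
    then show "(\<lambda>k. (b \<circ> r) k $ i) \<longlonglongrightarrow> a $ i"
      by (simp add: a_def diag_mat_def)
  qed
  then have "D = diag_mat a"
    using LIMSEQ_unique[OF D] tendsto_diag_mat[OF a] by (simp add: o_def)
  then have "W ** D ** conj_transpose W = rotated_diag W a"
    by (simp add: rotated_diag_def)
  then have "A = rotated_diag W a"
    by (simp add: D_def matrix_mul_assoc[symmetric] unitary_cancel[OF W])
      (use W in \<open>simp add: unitary_def\<close>)
  with r VW W a show ?thesis
    by (rule that)
qed

context symmetric_concave
begin

text \<open>The limit does not depend on the subsequence because the rotated gradient is a function of
  the matrix alone.\<close>

lemma spectral_grad_tendsto:
  fixes B :: "nat \<Rightarrow> complex ^ 'n ^ 'n"
  assumes lim: "B \<longlonglongrightarrow> A" and B: "\<And>k. B k = rotated_diag (V k) (b k)" and V: "\<And>k. unitary (V k)"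
    and A: "A = rotated_diag U a" and U: "unitary U" and a: "a \<in> \<Gamma>"
  obtains r where "strict_mono r" "eventually (\<lambda>k. b (r k) \<in> \<Gamma>) sequentially"
    "(\<lambda>k. rotated_diag (V (r k)) (g (b (r k)))) \<longlonglongrightarrow> rotated_diag U (g a)"
proof -
  obtain r W c where r: "strict_mono r" and VW: "(V \<circ> r) \<longlonglongrightarrow> W" and W: "unitary W"
    and bc: "(b \<circ> r) \<longlonglongrightarrow> c" and Ac: "A = rotated_diag W c"
    using rotated_diag_convergent_subsequence[OF lim B V] .
  obtain p where p: "p permutes UNIV" "c = (\<chi> i. a $ p i)"
    using eigenvalue_vector_unique eigenvalue_vector_rotated_diag[OF U, of a]
      eigenvalue_vector_rotated_diag[OF W, of c] A Ac by metis
  have c: "c \<in> \<Gamma>"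
    unfolding p(2) by (rule permuted_in_dom[OF a p(1)])
  have "eventually (\<lambda>k. (b \<circ> r) k \<in> \<Gamma>) sequentially"
    by (rule topological_tendstoD[OF bc open_dom c])
  moreover have "(\<lambda>k. g ((b \<circ> r) k)) \<longlonglongrightarrow> g c"
    using cont_grad open_dom c by (intro isCont_tendsto_compose[OF _ bc])
      (simp add: continuous_on_eq_continuous_at)
  then have "(\<lambda>k. rotated_diag (V (r k)) (g (b (r k)))) \<longlonglongrightarrow> rotated_diag W (g c)"
    unfolding rotated_diag_def using VW
    by (intro tendsto_matrix_mult tendsto_conj_transpose tendsto_diag_mat) (simp_all add: o_def)
  moreover have "rotated_diag U (g a) = rotated_diag W (g c)"
    using A Ac by (intro rotated_grad_unique[OF U W _ a p]) simp
  ultimately show ?thesis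
    using that[OF r] by simp
qed

text \<open>Differentiability of a concave function follows from continuity of a selection of
  supergradients: the tangent at \<open>A\<close> bounds the function from above, and the tangent at a nearby \<open>B\<close>,
  whose slope is close to the slope at \<open>A\<close>, bounds it from below.\<close>

lemma spectral_has_derivative:
  fixes A U :: "complex ^ 'n ^ 'n"
  assumes U: "unitary U" and A: "A = rotated_diag U (eigvals A)" and dom: "eigvals A \<in> \<Gamma>"
  shows "(spectral_fun h has_derivative (\<lambda>H. rotated_diag U (g (eigvals A)) \<bullet> H))
    (at A within {H. hermitian H})"
proof -
  define X where "X = rotated_diag U (g (eigvals A))"
  obtain V where V: "unitary (V B)" "B = rotated_diag (V B) (eigvals B)"
    if "hermitian B" for B :: "complex ^ 'n ^ 'n"
    using hermitian_eq_rotated_eigvals by metis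
  define Y where "Y B = rotated_diag (V B) (g (eigvals B))" for B
  have close: "\<exists>d>0. \<forall>B. hermitian B \<longrightarrow> norm (B - A) < d \<longrightarrow> eigvals B \<in> \<Gamma> \<and> norm (Y B - X) < e"
    if e: "0 < e" for e
  proof (rule ccontr)
    assume "\<not> ?thesis"
    then have bad: "\<exists>B. hermitian B \<and> norm (B - A) < d \<and>
        \<not> (eigvals B \<in> \<Gamma> \<and> norm (Y B - X) < e)" if "0 < d" for d
      using that by blast
    have "\<forall>k. \<exists>B. hermitian B \<and> norm (B - A) < inverse (real (Suc k)) \<and>
        \<not> (eigvals B \<in> \<Gamma> \<and> norm (Y B - X) < e)"
      by (intro allI bad) simp
    then obtain B where hB: "\<And>k. hermitian (B k)"
      and nB: "\<And>k. norm (B k - A) < inverse (real (Suc k))"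
      and bad: "\<And>k. \<not> (eigvals (B k) \<in> \<Gamma> \<and> norm (Y (B k) - X) < e)"
      by metis
    have "(\<lambda>k. B k - A) \<longlonglongrightarrow> 0"
      by (rule Lim_null_comparison[OF always_eventually LIMSEQ_inverse_real_of_nat])
        (use nB less_imp_le in blast)
    then have "B \<longlonglongrightarrow> A"
      by (simp add: LIM_zero_iff)
    then obtain r where "strict_mono r" "eventually (\<lambda>k. eigvals (B (r k)) \<in> \<Gamma>) sequentially"
      "(\<lambda>k. Y (B (r k))) \<longlonglongrightarrow> X"
      unfolding X_def Y_def
      by (rule spectral_grad_tendsto[OF _ V(2)[OF hB] V(1)[OF hB] A U dom])
    note sub = this
    have "eventually (\<lambda>k. norm (Y (B (r k)) - X) < e) sequentially"
      using sub(3) e by (auto simp: tendsto_iff dist_norm)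
    with sub(2) have "eventually (\<lambda>k. False) sequentially"
      by eventually_elim (use bad in blast)
    then show False
      by simp
  qed
  have "\<exists>d>0. \<forall>B\<in>{H. hermitian H}. norm (B - A) < d \<longrightarrow>
      norm (spectral_fun h B - spectral_fun h A - X \<bullet> (B - A)) \<le> e * norm (B - A)" if e: "0 < e" for e
  proof -
    obtain d where "d > 0" and d: "\<And>B. hermitian B \<Longrightarrow> norm (B - A) < d \<Longrightarrow>
        eigvals B \<in> \<Gamma> \<and> norm (Y B - X) < e"
      using close[OF e] by blast
    have "norm (spectral_fun h B - spectral_fun h A - X \<bullet> (B - A)) \<le> e * norm (B - A)"
      if B: "hermitian B" "norm (B - A) < d" for B
    proof -
      have "spectral_fun h B \<le> spectral_fun h A + X \<bullet> (B - A)"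
        using spectral_below_tangent[OF U V(1)[OF B(1)] dom conjunct1[OF d[OF B]]]
        by (simp add: spectral_fun_def X_def flip: A V(2)[OF B(1)])
      moreover have "spectral_fun h A \<le> spectral_fun h B + Y B \<bullet> (A - B)"
        using spectral_below_tangent[OF V(1)[OF B(1)] U conjunct1[OF d[OF B]] dom]
        by (simp add: spectral_fun_def Y_def flip: A V(2)[OF B(1)])
      moreover have "X \<bullet> (B - A) + Y B \<bullet> (A - B) = - ((Y B - X) \<bullet> (B - A))"
        by (simp add: inner_simps)
      moreover have "\<bar>(Y B - X) \<bullet> (B - A)\<bar> \<le> e * norm (B - A)"
        using Cauchy_Schwarz_ineq2[of "Y B - X" "B - A"] d[OF B]
        by (meson less_imp_le mult_right_mono norm_ge_zero order_trans)
      ultimately show ?thesis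
        unfolding real_norm_def by linarith
    qed
    with \<open>d > 0\<close> show ?thesis
      by blast
  qed
  then show ?thesis
    unfolding has_derivative_within_alt X_def[symmetric]
    by (auto intro: bounded_linear_inner_right)
qed

lemma spectral_has_hermitian_gradient:
  fixes A :: "complex ^ 'n ^ 'n"
  assumes hA: "hermitian A" and dom: "eigvals A \<in> \<Gamma>"
  obtains G where "has_hermitian_gradient (spectral_fun h) A G"
    and "det G = complex_of_real (\<Prod>i\<in>UNIV. g (eigvals A) $ i)"
proof -
  obtain U where U: "unitary U" and A: "A = rotated_diag U (eigvals A)"
    using hermitian_eq_rotated_eigvals[OF hA] .
  define X where "X = rotated_diag U (g (eigvals A))"
  have X: "hermitian X"
    by (simp add: X_def hermitian_rotated_diag)
  \<comment> \<open>The pairing \<open>\<Sum> G\<^sub>i\<^sub>j H\<^sub>i\<^sub>j\<close> has no conjugation, whence the transpose.\<close>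
  have "X \<bullet> H = Re (\<Sum>i\<in>UNIV. \<Sum>j\<in>UNIV. transpose X $ i $ j * H $ i $ j)" for H
  proof -
    have "x \<bullet> y = Re (cnj x * y)" for x y :: complex
      by (simp add: inner_complex_def)
    then show ?thesis
      unfolding inner_vec_def by (simp only: Re_sum transpose_def vec_lambda_beta hermitian_entry[OF X])
  qed
  moreover have "hermitian (transpose X)"
    using X by (simp add: hermitian_def vec_eq_iff conj_transpose_nth transpose_def)
  ultimately have "has_hermitian_gradient (spectral_fun h) A (transpose X)"
    using spectral_has_derivative[OF U A dom] by (simp add: has_hermitian_gradient_def X_def)
  moreover have "det (transpose X) = complex_of_real (\<Prod>i\<in>UNIV. g (eigvals A) $ i)"
    by (simp only: det_transpose X_def rotated_diag_def det_conj_unitary[OF U] det_diag_mat)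
  ultimately show ?thesis
    by (rule that)
qed

end

section \<open>The dual slice of a symmetric cone\<close>

locale symmetric_cone =
  fixes \<Gamma> :: "(real ^ 'n) set"
  assumes open_cone: "open \<Gamma>" and sym_cone: "symmetric_set \<Gamma>" and convex_cone: "convex \<Gamma>"
    and dilation: "dilation_invariant \<Gamma>"
    and Gamma_n_subset: "Gamma_n \<subseteq> \<Gamma>" and subset_Gamma_1: "\<Gamma> \<subseteq> Gamma_1"
begin

text \<open>The slice of the dual cone by the hyperplane \<open>\<Sum> y\<^sub>i = 1\<close>.  Since \<open>\<Gamma>\<close> contains the positive
  orthant, it is a compact part of the standard simplex; since \<open>\<Gamma>\<close> lies in the half-space
  \<open>\<Sum> x\<^sub>i > 0\<close>, it contains the barycentre.  It may have any dimension: for the half-space itself it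
  is a point.\<close>

definition dual_slice :: "(real ^ 'n) set" where
  "dual_slice = {y. (\<Sum>i\<in>UNIV. y $ i) = 1 \<and> (\<forall>x\<in>\<Gamma>. 0 \<le> x \<bullet> y)}"

lemma scale_in_cone: "x \<in> \<Gamma> \<Longrightarrow> 0 < t \<Longrightarrow> t *\<^sub>R x \<in> \<Gamma>"
  using dilation by (simp add: dilation_invariant_def)

lemma scale_in_cone_iff: "0 < t \<Longrightarrow> t *\<^sub>R x \<in> \<Gamma> \<longleftrightarrow> x \<in> \<Gamma>"
  using scale_in_cone[of x t] scale_in_cone[of "t *\<^sub>R x" "inverse t"] by auto

lemma add_in_cone:
  assumes "x \<in> \<Gamma>" and "y \<in> \<Gamma>"
  shows "x + y \<in> \<Gamma>"
proof -
  have "(1/2) *\<^sub>R x + (1/2) *\<^sub>R y \<in> \<Gamma>"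
    using convexD[OF convex_cone assms, of "1/2" "1/2"] by simp
  from scale_in_cone[OF this, of 2] show ?thesis
    by (simp add: scaleR_right_distrib)
qed

lemma one_in_cone: "1 \<in> \<Gamma>"
  using Gamma_n_subset by (auto simp: Gamma_n_def)

lemma sum_pos: "x \<in> \<Gamma> \<Longrightarrow> 0 < (\<Sum>i\<in>UNIV. x $ i)"
  using subset_Gamma_1 by (auto simp: Gamma_1_def)

lemma permute_in_cone_iff:
  assumes p: "p permutes UNIV"
  shows "(\<chi> i. x $ p i) \<in> \<Gamma> \<longleftrightarrow> x \<in> \<Gamma>"
proof
  assume "(\<chi> i. x $ p i) \<in> \<Gamma>"
  then have "(\<chi> i. (\<chi> i. x $ p i) $ inv p i) \<in> \<Gamma>"
    using sym_cone permutes_inv[OF p] unfolding symmetric_set_def by blast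
  then show "x \<in> \<Gamma>"
    by (simp add: permutes_inverses[OF p] vec_nth_inverse)
next
  assume "x \<in> \<Gamma>"
  then show "(\<chi> i. x $ p i) \<in> \<Gamma>"
    using sym_cone p unfolding symmetric_set_def by blast
qed

lemma dual_slice_nonneg:
  assumes "y \<in> dual_slice"
  shows "0 \<le> y $ i"
proof (rule ccontr)
  assume "\<not> 0 \<le> y $ i"
  then have neg: "y $ i < 0"
    by simp
  define x :: "real ^ 'n" where "x = 1 + (2 / - (y $ i)) *\<^sub>R axis i 1"
  have "x \<in> Gamma_n"
    unfolding Gamma_n_def x_def using neg
    by (auto simp: axis_def intro!: add_pos_nonneg simp: divide_nonneg_neg)
  then have "0 \<le> x \<bullet> y"
    using assms Gamma_n_subset by (auto simp: dual_slice_def)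
  moreover have "1 \<bullet> y = 1"
    using assms by (simp add: dual_slice_def inner_vec_def)
  ultimately show False
    using neg by (simp add: x_def inner_simps inner_axis')
qed

lemma dual_slice_le_1:
  assumes "y \<in> dual_slice"
  shows "y $ i \<le> 1"
  using member_le_sum[of i UNIV "\<lambda>i. y $ i"] dual_slice_nonneg[OF assms] assms
  by (simp add: dual_slice_def)

lemma norm_dual_slice:
  assumes "y \<in> dual_slice"
  shows "norm y \<le> 1"
  using norm_le_l1_cart[of y] dual_slice_nonneg[OF assms] assms by (simp add: dual_slice_def)

lemma convex_dual_slice: "convex dual_slice"
  unfolding dual_slice_def convex_def
  by (auto simp: sum.distrib inner_add_right simp flip: sum_distrib_left)

lemma closed_dual_slice: "closed dual_slice"
proof -
  have "dual_slice = {y. (\<Sum>i\<in>UNIV. y $ i) = 1} \<inter> (\<Inter>x\<in>\<Gamma>. {y. 0 \<le> x \<bullet> y})"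
    by (auto simp: dual_slice_def)
  moreover have "closed {y :: real ^ 'n. (\<Sum>i\<in>UNIV. y $ i) = 1}"
    by (intro closed_Collect_eq continuous_intros)
  ultimately show ?thesis
    by (auto intro!: closed_INT closed_Collect_le continuous_intros)
qed

lemma dual_slice_nonempty: "dual_slice \<noteq> {}"
proof -
  have "(1 / CARD('n)) *\<^sub>R 1 \<in> dual_slice"
    using sum_pos by (auto simp: dual_slice_def inner_vec_def simp flip: sum_divide_distrib
        intro!: divide_nonneg_nonneg less_imp_le)
  then show ?thesis
    by blast
qed

text \<open>A small multiple of \<open>y\<close> can be subtracted from \<open>x\<close> without leaving the open cone.\<close>

lemma inner_dual_slice_pos:
  assumes x: "x \<in> \<Gamma>" and y: "y \<in> dual_slice"
  shows "0 < x \<bullet> y"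
proof -
  obtain e where e: "0 < e" "cball x e \<subseteq> \<Gamma>"
    using open_cone x open_contains_cball by blast
  have "y \<noteq> 0"
    using y by (auto simp: dual_slice_def)
  then have "x - (e / norm y) *\<^sub>R y \<in> cball x e"
    using e(1) by (simp add: dist_norm)
  then have "x - (e / norm y) *\<^sub>R y \<in> \<Gamma>"
    by (rule subsetD[OF e(2)])
  then have "0 \<le> (x - (e / norm y) *\<^sub>R y) \<bullet> y"
    using y unfolding dual_slice_def by blast
  then have "(e / norm y) * (y \<bullet> y) \<le> x \<bullet> y"
    by (simp add: inner_diff_left)
  moreover have "0 < (e / norm y) * (y \<bullet> y)"
    using e(1) \<open>y \<noteq> 0\<close> by simp
  ultimately show ?thesis
    by linarith
qed

text \<open>A hyperplane separating \<open>x0\<close> from the cone passes through the origin, because the cone is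
  invariant under dilations.  Its normal is positive on the interior point \<open>1\<close>, so it can be
  normalized to have coordinate sum \<open>1\<close>.\<close>

lemma supporting_dual_slice:
  assumes x0: "x0 \<in> frontier \<Gamma>"
  obtains y where "y \<in> dual_slice" "x0 \<bullet> y = 0"
proof -
  have "x0 \<notin> \<Gamma>" and cl: "x0 \<in> closure \<Gamma>"
    using x0 open_cone by (auto simp: frontier_def interior_open)
  then obtain a b where a: "a \<noteq> 0" and b: "a \<bullet> x0 \<le> b" "\<And>x. x \<in> \<Gamma> \<Longrightarrow> b \<le> a \<bullet> x"
    using separating_hyperplane_sets[of "{x0}" \<Gamma>] convex_cone one_in_cone by auto
  have nonneg: "0 \<le> a \<bullet> x" if x: "x \<in> \<Gamma>" for x
  proof (rule ccontr)
    assume "\<not> 0 \<le> a \<bullet> x"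
    then have neg: "a \<bullet> x < 0"
      by simp
    define t where "t = (\<bar>b\<bar> + 1) / - (a \<bullet> x)"
    have "0 < t"
      unfolding t_def using neg by (intro divide_pos_pos) auto
    from b(2)[OF scale_in_cone[OF x this]] show False
      using neg by (simp add: t_def)
  qed
  have "closure \<Gamma> \<subseteq> {x. 0 \<le> a \<bullet> x}"
    using nonneg by (intro closure_minimal closed_Collect_le continuous_intros) auto
  with cl have "0 \<le> a \<bullet> x0"
    by blast
  moreover have "b \<le> 0"
  proof (rule ccontr)
    assume "\<not> b \<le> 0"
    define t where "t = b / (2 * (a \<bullet> 1))"
    have "b \<le> a \<bullet> 1"
      by (rule b(2)[OF one_in_cone])
    with \<open>\<not> b \<le> 0\<close> have "0 < t" "t * (a \<bullet> 1) = b / 2"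
      by (simp_all add: t_def)
    from b(2)[OF scale_in_cone[OF one_in_cone this(1)]] this(2) \<open>\<not> b \<le> 0\<close> show False
      by simp
  qed
  ultimately have zero: "a \<bullet> x0 = 0"
    using b(1) by linarith
  obtain e where e: "0 < e" "cball 1 e \<subseteq> \<Gamma>"
    using open_cone one_in_cone open_contains_cball by blast
  have "1 - (e / norm a) *\<^sub>R a \<in> \<Gamma>"
    using e a by (intro subsetD[OF e(2)]) (simp add: dist_norm)
  from nonneg[OF this] have "(e / norm a) * (a \<bullet> a) \<le> a \<bullet> 1"
    by (simp add: inner_diff_right)
  moreover have "0 < (e / norm a) * (a \<bullet> a)"
    using e(1) a by simp
  ultimately have pos: "0 < a \<bullet> 1"
    by linarith
  then have "(\<Sum>i\<in>UNIV. a $ i) = a \<bullet> 1"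
    by (simp add: inner_vec_def)
  then have "(1 / (a \<bullet> 1)) *\<^sub>R a \<in> dual_slice"
    using pos nonneg by (auto simp: dual_slice_def inner_commute[of _ a] simp flip: sum_divide_distrib)
  moreover have "x0 \<bullet> ((1 / (a \<bullet> 1)) *\<^sub>R a) = 0"
    using zero by (simp add: inner_commute)
  ultimately show ?thesis
    by (rule that)
qed

section \<open>Potentials of the cone\<close>

definition proj :: "real ^ 'n \<Rightarrow> real ^ 'n" where
  "proj = closest_point dual_slice"

text \<open>Push the Lebesgue measure of the unit cube forward to the dual slice under the nearest point
  projection.  The projection is \<open>1\<close>-Lipschitz, so every ball of radius \<open>r \<le> 1\<close> around a point of
  the slice gets mass at least of order \<open>r\<^sup>n\<close>, whatever the dimension of the slice.  The potential
  with \<open>w = 1\<close> integrates \<open>(x \<bullet> y) ^ (- q)\<close> against this measure; general weights \<open>w\<close> make the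
  family closed under directional derivatives.\<close>

definition potential :: "(real ^ 'n \<Rightarrow> real) \<Rightarrow> nat \<Rightarrow> real ^ 'n \<Rightarrow> real" where
  "potential w q x = integral (cbox 0 1) (\<lambda>u. w u / (x \<bullet> proj u) ^ q)"

lemma proj_in_dual_slice: "proj u \<in> dual_slice"
  unfolding proj_def by (rule closest_point_in_set[OF closed_dual_slice dual_slice_nonempty])

lemma continuous_on_proj [continuous_intros]:
  "continuous_on S f \<Longrightarrow> continuous_on S (\<lambda>x. proj (f x))"
  unfolding proj_def
  by (rule continuous_on_compose2[OF continuous_on_closest_point[OF convex_dual_slice
          closed_dual_slice dual_slice_nonempty, of UNIV]]) auto

lemma inner_proj_pos: "x \<in> \<Gamma> \<Longrightarrow> 0 < x \<bullet> proj u"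
  by (rule inner_dual_slice_pos[OF _ proj_in_dual_slice])

lemma integrand_continuous:
  assumes "continuous_on UNIV w" and "x \<in> \<Gamma>"
  shows "continuous_on S (\<lambda>u. w u / (x \<bullet> proj u) ^ q)"
  using inner_proj_pos[OF assms(2)]
  by (intro continuous_intros continuous_on_subset[OF assms(1)]) (auto simp: less_imp_neq[symmetric])

lemma integrand_integrable:
  assumes "continuous_on UNIV w" and "x \<in> \<Gamma>"
  shows "(\<lambda>u. w u / (x \<bullet> proj u) ^ q) integrable_on cbox a b"
  by (rule integrable_continuous[OF integrand_continuous[OF assms]])

lemma potential_has_derivative:
  assumes w: "continuous_on UNIV w" and x: "x \<in> \<Gamma>"
  shows "(potential w q has_derivative
    (\<lambda>v. potential (\<lambda>u. - (real q * w u * (v \<bullet> proj u))) (Suc q) x)) (at x)"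
proof -
  define D :: "real ^ 'n \<Rightarrow> real ^ 'n \<Rightarrow> ((real ^ 'n) \<Rightarrow>\<^sub>L real)" where
    "D x u = (- (real q * w u) / (x \<bullet> proj u) ^ Suc q) *\<^sub>R blinfun_inner_left (proj u)" for x u
  have der: "((\<lambda>x. w u / (x \<bullet> proj u) ^ q) has_derivative blinfun_apply (D x u)) (at x within \<Gamma>)"
    if x: "x \<in> \<Gamma>" for x u
  proof -
    let ?s = "x \<bullet> proj u"
    have s: "?s \<noteq> 0"
      using inner_proj_pos[OF x, of u] by simp
    have pw: "t * t ^ (n - Suc 0) = t ^ n" if "0 < n" for t :: real and n
      using that by (cases n) auto
    have "((\<lambda>s. w u / s ^ q) has_real_derivative - (real q * w u) / ?s ^ Suc q) (at ?s)"
      using s by (cases q) (auto intro!: derivative_eq_intros simp: field_simps pw)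
    then have "((\<lambda>s. w u / s ^ q) has_derivative (\<lambda>t. - (real q * w u) / ?s ^ Suc q * t)) (at ?s)"
      unfolding has_field_derivative_def .
    note has_derivative_compose[OF bounded_linear_imp_has_derivative[OF bounded_linear_inner_left] this]
    moreover have "blinfun_apply (D x u) = (\<lambda>v. - (real q * w u) / ?s ^ Suc q * (v \<bullet> proj u))"
      by (rule ext) (simp add: D_def blinfun.scaleR_left blinfun.minus_left)
    ultimately show ?thesis
      by simp
  qed
  have cont: "continuous_on (\<Gamma> \<times> cbox 0 1) (\<lambda>(x, u). D x u)"
  proof -
    have "continuous_on (\<Gamma> \<times> cbox 0 1) (\<lambda>z. w (snd z))"
      by (rule continuous_on_compose2[OF w]) (auto intro!: continuous_intros)
    moreover have "continuous_on (\<Gamma> \<times> cbox 0 1) (\<lambda>z. blinfun_inner_left (proj (snd z)))"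
      by (intro bounded_linear.continuous_on[OF bounded_linear_blinfun_inner_left] continuous_intros)
    moreover have "z \<in> \<Gamma> \<times> cbox 0 1 \<Longrightarrow> (fst z \<bullet> proj (snd z)) ^ Suc q \<noteq> 0" for z
      using inner_proj_pos[of "fst z" "snd z"] by auto
    ultimately show ?thesis
      unfolding D_def case_prod_beta by (intro continuous_intros) auto
  qed
  have "((\<lambda>x. integral (cbox 0 1) (\<lambda>u. w u / (x \<bullet> proj u) ^ q)) has_derivative
      blinfun_apply (integral (cbox 0 1) (D x))) (at x within \<Gamma>)"
    by (rule leibniz_rule[OF der integrand_integrable[OF w] cont x convex_cone])
  moreover have "D x integrable_on cbox 0 1"
    by (intro integrable_continuous continuous_on_compose2[OF cont, of _ "\<lambda>u. (x, u)", simplified])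
      (use x in \<open>auto intro!: continuous_intros\<close>)
  then have "blinfun_apply (integral (cbox 0 1) (D x))
      = (\<lambda>v. potential (\<lambda>u. - (real q * w u * (v \<bullet> proj u))) (Suc q) x)"
    by (intro ext, subst blinfun_apply_integral) (simp_all add: D_def potential_def blinfun.scaleR_left blinfun.minus_left)
  ultimately show ?thesis
    unfolding at_within_open[OF x open_cone] by (simp only: potential_def[abs_def])
qed

lemma Ck_on_potential:
  assumes "continuous_on UNIV w"
  shows "Ck_on k \<Gamma> (potential w q)"
  using assms
proof (induction k arbitrary: w q)
  case 0
  then show ?case
    using has_derivative_continuous[OF potential_has_derivative[OF 0]]
    by (auto intro!: continuous_at_imp_continuous_on)
next
  case (Suc k)
  show ?case
    by (rule Ck_on_SucI[OF open_cone potential_has_derivative[OF Suc.prems]])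
      (auto intro!: Suc.IH continuous_intros Suc.prems)
qed

text \<open>Restricting the integral to a box on which the projections pair with \<open>x\<close> to at most \<open>c\<close> gives
  the lower bound that drives both positivity and the blow-up at the boundary.\<close>

lemma potential_one_ge:
  assumes x: "x \<in> \<Gamma>" and sub: "cbox a b \<subseteq> cbox 0 1" and ne: "cbox a b \<noteq> {}"
    and c: "\<And>u. u \<in> cbox a b \<Longrightarrow> x \<bullet> proj u \<le> c"
  shows "measure lborel (cbox a b) / c ^ q \<le> potential (\<lambda>u. 1) q x"
proof -
  have "1 / c ^ q * measure lborel (cbox a b) \<le> integral (cbox a b) (\<lambda>u. 1 / (x \<bullet> proj u) ^ q)"
  proof -
    have "1 / c ^ q \<le> 1 / (x \<bullet> proj u) ^ q" if "u \<in> cbox a b" for u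
      using c[OF that] inner_proj_pos[OF x, of u]
      by (intro divide_left_mono power_mono mult_pos_pos zero_less_power) auto
    then show ?thesis
      using integral_component_lbound[OF integrand_integrable[OF _ x, of "\<lambda>u. 1" q a b], of "1 / c ^ q" 1]
      by simp
  qed
  also have "\<dots> \<le> potential (\<lambda>u. 1) q x"
    unfolding potential_def
    by (rule integral_subset_le[OF sub])
      (use x inner_proj_pos[OF x] in \<open>auto intro!: integrand_integrable zero_le_power less_imp_le\<close>)
  finally show ?thesis
    by simp
qed

lemma content_unit_cube: "measure lborel (cbox 0 (1 :: real ^ 'n)) = 1"
  by (subst content_cbox_cart) (auto simp: interval_ne_empty_cart mem_box_cart intro!: exI[of _ 0])

lemma potential_one_le:
  assumes x: "x \<in> \<Gamma>" and c: "0 < c" "\<And>y. y \<in> dual_slice \<Longrightarrow> c \<le> x \<bullet> y"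
  shows "potential (\<lambda>u. 1) q x \<le> 1 / c ^ q"
proof -
  have "integral (cbox 0 1) (\<lambda>u. 1 / (x \<bullet> proj u) ^ q) \<bullet> 1 \<le> 1 / c ^ q * measure lborel (cbox 0 (1 :: real ^ 'n))"
    using c proj_in_dual_slice inner_proj_pos[OF x]
    by (intro integral_component_ubound integrand_integrable x)
      (auto intro!: divide_left_mono power_mono mult_pos_pos zero_less_power intro: less_imp_le)
  then show ?thesis
    by (simp add: potential_def content_unit_cube)
qed

lemma potential_one_pos:
  assumes "x \<in> \<Gamma>"
  shows "0 < potential (\<lambda>u. 1) q x"
proof -
  have "x \<noteq> 0"
    using sum_pos[OF assms] by auto
  have "x \<bullet> proj u \<le> norm x" for u
    using norm_cauchy_schwarz[of x "proj u"] mult_left_mono[OF norm_dual_slice[OF proj_in_dual_slice, of u], of "norm x"]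
    by simp
  then have "measure lborel (cbox 0 (1 :: real ^ 'n)) / norm x ^ q \<le> potential (\<lambda>u. 1) q x"
    by (intro potential_one_ge assms) (auto simp: interval_ne_empty_cart)
  moreover have "0 < measure lborel (cbox 0 (1 :: real ^ 'n)) / norm x ^ q"
    using \<open>x \<noteq> 0\<close> by (simp add: content_unit_cube)
  ultimately show ?thesis
    by linarith
qed

lemma potential_one_scale:
  assumes "0 < t"
  shows "potential (\<lambda>u. 1) q (t *\<^sub>R x) = potential (\<lambda>u. 1) q x / t ^ q"
proof -
  have "(\<lambda>u. 1 / ((t *\<^sub>R x) \<bullet> proj u) ^ q) = (\<lambda>u. 1 / t ^ q * (1 / (x \<bullet> proj u) ^ q))"
    by (simp add: power_mult_distrib)
  then show ?thesis
    by (simp only: potential_def integral_mult_right) simp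
qed

end

section \<open>Symmetry and concavity of the mean\<close>

definition permute_vec :: "('n \<Rightarrow> 'n) \<Rightarrow> real ^ 'n \<Rightarrow> real ^ 'n" where
  "permute_vec p x = (\<chi> i. x $ p i)"

lemma permute_vec_nth [simp]: "permute_vec p x $ i = x $ p i"
  by (simp add: permute_vec_def)

lemma permute_vec_inv:
  assumes "p permutes UNIV"
  shows "permute_vec p (permute_vec (inv p) x) = x" "permute_vec (inv p) (permute_vec p x) = x"
  by (simp_all add: vec_eq_iff permutes_inverses[OF assms])

lemma inner_permute_vec:
  assumes "p permutes UNIV"
  shows "permute_vec p x \<bullet> permute_vec p y = x \<bullet> y"
  using sum.permute[OF assms, of "\<lambda>i. x $ i * y $ i"] by (simp add: inner_vec_def o_def)

lemma linear_permute_vec: "linear (permute_vec p)"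
  by (rule linearI) (simp_all add: vec_eq_iff)

lemma dist_permute_vec:
  assumes "p permutes UNIV"
  shows "dist (permute_vec p x) (permute_vec p y) = dist x y"
  by (simp add: dist_norm norm_eq_sqrt_inner inner_permute_vec[OF assms]
      flip: linear_diff[OF linear_permute_vec])

lemma permute_vec_image_cbox:
  assumes p: "p permutes UNIV"
  shows "permute_vec p ` cbox a b = cbox (permute_vec p a) (permute_vec p b)"
proof -
  have "z \<in> permute_vec p ` cbox a b" if z: "z \<in> cbox (permute_vec p a) (permute_vec p b)" for z
  proof (rule image_eqI)
    show "z = permute_vec p (permute_vec (inv p) z)"
      by (simp add: permute_vec_inv[OF p])
    have "a $ p (inv p i) \<le> z $ inv p i \<and> z $ inv p i \<le> b $ p (inv p i)" for i
      using z by (simp add: mem_box_cart)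
    then show "permute_vec (inv p) z \<in> cbox a b"
      by (simp add: mem_box_cart permutes_inverses[OF p])
  qed
  then show ?thesis
    by (auto simp: mem_box_cart)
qed

lemma content_permute_vec_image:
  assumes p: "p permutes UNIV"
  shows "measure lborel (permute_vec p ` cbox a b) = measure lborel (cbox a b)"
proof (cases "cbox a b = {}")
  case False
  then have "cbox (permute_vec p a) (permute_vec p b) \<noteq> {}"
    by (simp flip: permute_vec_image_cbox[OF p])
  then show ?thesis
    using False sum.permute[OF p] prod.permute[OF p, of "\<lambda>i. b $ i - a $ i"]
    by (simp add: permute_vec_image_cbox[OF p] content_cbox_cart o_def)
qed simp

lemma integral_permute_vec:
  assumes p: "p permutes UNIV" and f: "f integrable_on cbox 0 1"
  shows "integral (cbox 0 1) (\<lambda>u. f (permute_vec p u)) = integral (cbox 0 1) f"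
proof -
  have q: "inv p permutes UNIV"
    by (rule permutes_inv[OF p])
  have "((\<lambda>u. f (permute_vec p u)) has_integral (1 / 1) *\<^sub>R integral (cbox 0 1) f)
      (permute_vec (inv p) ` cbox 0 1)"
    by (rule has_integral_twiddle)
      (use f in \<open>auto simp: permute_vec_inv[OF p] permute_vec_image_cbox[OF p] permute_vec_image_cbox[OF q]
          content_permute_vec_image[OF p, unfolded permute_vec_image_cbox[OF p]]
        intro: linear_continuous_at simp: linear_conv_bounded_linear[symmetric] linear_permute_vec\<close>)
  moreover have "permute_vec (inv p) ` cbox 0 1 = cbox 0 1"
    by (simp add: permute_vec_image_cbox[OF q]) (simp add: permute_vec_def vec_eq_iff flip: one_vec_def zero_vec_def)
  ultimately show ?thesis
    by (simp add: integral_unique)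
qed

lemma inverse_power_convex:
  fixes s r :: real
  assumes "0 < s" "0 < r" "0 \<le> u" "0 \<le> v" "u + v = 1"
  shows "1 / (u * s + v * r) ^ q \<le> u * (1 / s ^ q) + v * (1 / r ^ q)"
proof -
  have pos: "0 < u * s + v * r"
    using assms by (cases "u = 0") (auto intro!: add_pos_nonneg)
  have "inverse (u * s + v * r) \<le> u * inverse s + v * inverse r"
  proof -
    have "convex_on {0<..} (inverse :: real \<Rightarrow> real)"
      by (rule convex_on_inverse) auto
    then have "\<forall>x\<in>{0<..}. \<forall>y\<in>{0<..}. \<forall>u\<ge>0. \<forall>v\<ge>0. u + v = 1 \<longrightarrow>
        inverse (u *\<^sub>R x + v *\<^sub>R y :: real) \<le> u * inverse x + v * inverse y"
      unfolding convex_on_def by blast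
    from this[rule_format, of s r u v] show ?thesis
      using assms by simp
  qed
  then have "inverse (u * s + v * r) ^ q \<le> (u * inverse s + v * inverse r) ^ q"
    using pos by (intro power_mono) auto
  also have "\<dots> \<le> u * inverse s ^ q + v * inverse r ^ q"
  proof -
    have "convex_on {0..} (\<lambda>t :: real. t ^ q)"
      by (cases "even q")
        (auto intro: convex_power_odd convex_on_subset[OF convex_power_even])
    then have "\<forall>x\<in>{0..}. \<forall>y\<in>{0..}. \<forall>u\<ge>0. \<forall>v\<ge>0. u + v = 1 \<longrightarrow>
        (u *\<^sub>R x + v *\<^sub>R y :: real) ^ q \<le> u * x ^ q + v * y ^ q"
      unfolding convex_on_def by blast
    from this[rule_format, of "inverse s" "inverse r" u v] show ?thesis
      using assms by simp
  qed
  finally show ?thesis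
    by (simp add: inverse_eq_divide power_one_over)
qed

text \<open>After division by the right-hand side this is the sum of two instances of the weighted
  inequality between geometric and arithmetic means.\<close>

lemma weighted_geometric_mean_superadditive:
  fixes a b c d \<alpha> :: real
  assumes pos: "0 < a" "0 < b" "0 < c" "0 < d" and \<alpha>: "0 \<le> \<alpha>" "\<alpha> \<le> 1"
  shows "a powr \<alpha> * b powr (1 - \<alpha>) + c powr \<alpha> * d powr (1 - \<alpha>)
    \<le> (a + c) powr \<alpha> * (b + d) powr (1 - \<alpha>)"
proof -
  define P where "P = (a + c) powr \<alpha> * (b + d) powr (1 - \<alpha>)"
  have split: "x powr \<alpha> * y powr (1 - \<alpha>) \<le> P * (\<alpha> * (x / (a + c)) + (1 - \<alpha>) * (y / (b + d)))"
    if "0 < x" "0 < y" for x y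
  proof -
    have "P * ((x / (a + c)) powr \<alpha> * (y / (b + d)) powr (1 - \<alpha>)) = x powr \<alpha> * y powr (1 - \<alpha>)"
      using pos that by (simp add: P_def powr_divide)
    moreover have "(x / (a + c)) powr \<alpha> * (y / (b + d)) powr (1 - \<alpha>)
        \<le> \<alpha> * (x / (a + c)) + (1 - \<alpha>) * (y / (b + d))"
      using pos that \<alpha> by (intro Youngs_inequality_0) auto
    moreover have "0 \<le> P"
      by (simp add: P_def)
    ultimately show ?thesis
      by (metis mult_left_mono)
  qed
  have "a / (a + c) + c / (a + c) = 1" "b / (b + d) + d / (b + d) = 1"
    using pos by (simp_all flip: add_divide_distrib)
  then have "\<alpha> * (a / (a + c)) + (1 - \<alpha>) * (b / (b + d))
      + (\<alpha> * (c / (a + c)) + (1 - \<alpha>) * (d / (b + d))) = 1"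
    by algebra
  then have "P * (\<alpha> * (a / (a + c)) + (1 - \<alpha>) * (b / (b + d)))
      + P * (\<alpha> * (c / (a + c)) + (1 - \<alpha>) * (d / (b + d))) = P"
    by (metis distrib_left mult.right_neutral)
  then show ?thesis
    using split[OF pos(1,2)] split[OF pos(3,4)] by (simp add: P_def)
qed

context symmetric_cone
begin

text \<open>The power mean with exponent \<open>- (n + 1)\<close> of the numbers \<open>x \<bullet> proj u\<close> over the unit cube.  With
  an order larger than the dimension, the mean vanishes at the boundary.\<close>

definition mean :: "real ^ 'n \<Rightarrow> real" where
  "mean x = potential (\<lambda>u. 1) (Suc CARD('n)) x powr (- 1 / real (Suc CARD('n)))"

lemma permute_vec_dual_slice:
  assumes p: "p permutes UNIV" and y: "y \<in> dual_slice"
  shows "permute_vec p y \<in> dual_slice"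
proof -
  have "0 \<le> x \<bullet> permute_vec p y" if "x \<in> \<Gamma>" for x
  proof -
    have "permute_vec (inv p) x \<in> \<Gamma>"
      using permute_in_cone_iff[OF permutes_inv[OF p]] that by (simp add: permute_vec_def)
    then have "0 \<le> permute_vec (inv p) x \<bullet> y"
      using y by (simp add: dual_slice_def)
    then show ?thesis
      using inner_permute_vec[OF p, of "permute_vec (inv p) x" y] by (simp add: permute_vec_inv[OF p])
  qed
  moreover have "(\<Sum>i\<in>UNIV. permute_vec p y $ i) = 1"
    using sum.permute[OF p, of "\<lambda>i. y $ i"] y by (simp add: dual_slice_def o_def)
  ultimately show ?thesis
    by (simp add: dual_slice_def)
qed

lemma proj_permute_vec:
  assumes p: "p permutes UNIV"
  shows "proj (permute_vec p u) = permute_vec p (proj u)"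
proof -
  have "dist (permute_vec p u) (permute_vec p (proj u)) \<le> dist (permute_vec p u) z"
    if "z \<in> dual_slice" for z
  proof -
    have "dist u (proj u) \<le> dist u (permute_vec (inv p) z)"
      unfolding proj_def
      by (intro closest_point_le closed_dual_slice permute_vec_dual_slice permutes_inv[OF p] that)
    then show ?thesis
      using dist_permute_vec[OF p, of u "permute_vec (inv p) z"]
      by (simp add: dist_permute_vec[OF p] permute_vec_inv[OF p])
  qed
  then have "permute_vec p (proj u) = closest_point dual_slice (permute_vec p u)"
    by (intro closest_point_unique convex_dual_slice closed_dual_slice permute_vec_dual_slice[OF p]
        proj_in_dual_slice) auto
  then show ?thesis
    by (simp add: proj_def)
qed

lemma potential_one_permute:
  assumes p: "p permutes UNIV" and x: "x \<in> \<Gamma>"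
  shows "potential (\<lambda>u. 1) q (permute_vec p x) = potential (\<lambda>u. 1) q x"
proof -
  have q: "inv p permutes UNIV"
    by (rule permutes_inv[OF p])
  have "permute_vec p x \<bullet> proj u = x \<bullet> proj (permute_vec (inv p) u)" for u
    using inner_permute_vec[OF q, of "permute_vec p x" "proj u"]
    by (simp add: proj_permute_vec[OF q] permute_vec_inv[OF p])
  then show ?thesis
    unfolding potential_def
    using integral_permute_vec[OF q integrand_integrable[OF _ x, of "\<lambda>u. 1" q]] by simp
qed

lemma potential_one_convex:
  assumes x: "x \<in> \<Gamma>" and y: "y \<in> \<Gamma>" and uv: "0 \<le> u" "0 \<le> v" "u + v = 1"
  shows "potential (\<lambda>u. 1) q (u *\<^sub>R x + v *\<^sub>R y)
    \<le> u * potential (\<lambda>u. 1) q x + v * potential (\<lambda>u. 1) q y"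
proof -
  let ?f = "\<lambda>x t. 1 / (x \<bullet> proj t) ^ q"
  have int: "?f x integrable_on cbox 0 1" if "x \<in> \<Gamma>" for x
    by (rule integrand_integrable[OF _ that]) simp
  have z: "u *\<^sub>R x + v *\<^sub>R y \<in> \<Gamma>"
    using convexD[OF convex_cone x y uv] .
  have "integral (cbox 0 1) (?f (u *\<^sub>R x + v *\<^sub>R y))
      \<le> integral (cbox 0 1) (\<lambda>t. u * ?f x t + v * ?f y t)"
  proof (rule integral_le)
    fix t
    show "?f (u *\<^sub>R x + v *\<^sub>R y) t \<le> u * ?f x t + v * ?f y t"
      using inverse_power_convex[OF inner_proj_pos[OF x] inner_proj_pos[OF y] uv]
      by (simp add: inner_add_left)
  qed (intro int z integrable_add integrable_on_mult_right x y)+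
  also have "\<dots> = u * integral (cbox 0 1) (?f x) + v * integral (cbox 0 1) (?f y)"
    by (subst integral_add[OF integrable_on_mult_right[OF int[OF x]]
          integrable_on_mult_right[OF int[OF y]]]) (simp only: integral_mult_right)
  finally show ?thesis
    by (simp add: potential_def)
qed

lemma mean_pos: "x \<in> \<Gamma> \<Longrightarrow> 0 < mean x"
  using potential_one_pos[of x "Suc CARD('n)"] by (simp add: mean_def)

lemma mean_power:
  assumes "x \<in> \<Gamma>"
  shows "mean x ^ Suc CARD('n) = 1 / potential (\<lambda>u. 1) (Suc CARD('n)) x"
proof -
  have "mean x ^ Suc CARD('n) = mean x powr real (Suc CARD('n))"
    by (rule powr_realpow[OF mean_pos[OF assms], symmetric])
  also have "\<dots> = potential (\<lambda>u. 1) (Suc CARD('n)) x powr (- 1)"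
    unfolding mean_def powr_powr by simp
  finally show ?thesis
    using potential_one_pos[OF assms, of "Suc CARD('n)"] by (simp add: powr_minus_divide)
qed

lemma mean_le_iff:
  assumes "x \<in> \<Gamma>" and "0 \<le> c"
  shows "c \<le> mean x \<longleftrightarrow> c ^ Suc CARD('n) * potential (\<lambda>u. 1) (Suc CARD('n)) x \<le> 1"
proof -
  have "c \<le> mean x \<longleftrightarrow> c ^ Suc CARD('n) \<le> mean x ^ Suc CARD('n)"
    using mean_pos[OF assms(1)] assms(2) by (simp add: power_mono_iff del: power_Suc)
  then show ?thesis
    using potential_one_pos[OF assms(1), of "Suc CARD('n)"] by (simp add: mean_power[OF assms(1)] pos_le_divide_eq del: power_Suc)
qed

lemma mean_scale:
  assumes x: "x \<in> \<Gamma>" and t: "0 < t"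
  shows "mean (t *\<^sub>R x) = t * mean x"
proof (rule power_eq_imp_eq_base)
  show "mean (t *\<^sub>R x) ^ Suc CARD('n) = (t * mean x) ^ Suc CARD('n)"
    unfolding power_mult_distrib mean_power[OF x] mean_power[OF scale_in_cone[OF x t]]
      potential_one_scale[OF t] by simp
qed (use t mean_pos[OF x] mean_pos[OF scale_in_cone[OF x t]] in auto)

text \<open>A positive function that is homogeneous of degree one is superadditive as soon as its
  superlevel set at height one is convex; here this set is a sublevel set of a convex potential.\<close>

lemma mean_superadditive:
  assumes x: "x \<in> \<Gamma>" and y: "y \<in> \<Gamma>"
  shows "mean x + mean y \<le> mean (x + y)"
proof -
  define a b where "a = mean x" and "b = mean y"
  have ab: "0 < a" "0 < b"
    using mean_pos x y by (auto simp: a_def b_def)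
  let ?\<phi> = "potential (\<lambda>u. 1) (Suc CARD('n))"
  have level: "?\<phi> ((1 / mean w) *\<^sub>R w) = 1" if "w \<in> \<Gamma>" for w
    using potential_one_pos[OF that, of "Suc CARD('n)"] mean_pos[OF that] potential_one_scale[of "1 / mean w" "Suc CARD('n)" w]
    by (simp add: power_one_over mean_power[OF that] del: power_Suc)
  define z where "z = (a / (a + b)) *\<^sub>R ((1 / a) *\<^sub>R x) + (b / (a + b)) *\<^sub>R ((1 / b) *\<^sub>R y)"
  have "?\<phi> z \<le> a / (a + b) * ?\<phi> ((1 / a) *\<^sub>R x) + b / (a + b) * ?\<phi> ((1 / b) *\<^sub>R y)"
    unfolding z_def using ab
    by (intro potential_one_convex scale_in_cone x y) (auto simp flip: add_divide_distrib)
  also have "\<dots> = 1"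
    using level[OF x] level[OF y] ab by (simp add: a_def b_def flip: add_divide_distrib)
  finally have z: "?\<phi> z \<le> 1" .
  have xy: "x + y = (a + b) *\<^sub>R z"
    using ab by (simp add: z_def scaleR_right_distrib)
  have "(a + b) ^ Suc CARD('n) * ?\<phi> (x + y) = ?\<phi> z"
    using ab unfolding xy by (subst potential_one_scale) auto
  then show ?thesis
    using z mean_le_iff[OF add_in_cone[OF x y], of "a + b"] ab by (simp add: a_def b_def)
qed

lemma mean_permute: "p permutes UNIV \<Longrightarrow> x \<in> \<Gamma> \<Longrightarrow> mean (permute_vec p x) = mean x"
  by (simp add: mean_def potential_one_permute)

text \<open>A point \<open>y\<close> of the dual slice has nonnegative coordinates with sum \<open>1\<close>, so \<open>x \<bullet> y\<close> is a
  weighted average of the coordinates of \<open>x\<close>.\<close>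

lemma mean_ge_of_coordinates_ge:
  assumes x: "x \<in> \<Gamma>" and m: "0 < m" "\<And>i. m \<le> x $ i"
  shows "m \<le> mean x"
proof -
  have "m \<le> x \<bullet> y" if y: "y \<in> dual_slice" for y
  proof -
    have "m = (\<Sum>i\<in>UNIV. m * y $ i)"
      using y by (simp add: dual_slice_def flip: sum_distrib_left)
    also have "\<dots> \<le> x \<bullet> y"
      unfolding inner_vec_def using m dual_slice_nonneg[OF y] by (auto intro!: sum_mono mult_right_mono)
    finally show ?thesis .
  qed
  then have "potential (\<lambda>u. 1) (Suc CARD('n)) x \<le> 1 / m ^ Suc CARD('n)"
    by (rule potential_one_le[OF x m(1)])
  then show ?thesis
    using m(1) mean_le_iff[OF x, of m]
    by (simp add: pos_le_divide_eq mult.commute del: power_Suc)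
qed

section \<open>Boundary behaviour of the mean\<close>

text \<open>Let \<open>y\<close> in the dual slice vanish at the boundary point \<open>x0\<close>.  If \<open>x\<close> has distance \<open>r\<close> from
  \<open>x0\<close>, then \<open>x \<bullet> proj u\<close> is at most of order \<open>r\<close> on a cube of side \<open>r / n\<close> around \<open>y\<close>.  The exponent \<open>n + 1\<close>
  beats the volume \<open>(r / n)\<^sup>n\<close>, so the potential is at least of order \<open>1 / r\<close>.\<close>

lemma potential_one_near_frontier:
  assumes x0: "x0 \<in> frontier \<Gamma>"
  obtains c where "0 < c"
    and "\<And>x. x \<in> \<Gamma> \<Longrightarrow> norm (x - x0) \<le> 1 \<Longrightarrow> c / norm (x - x0) \<le> potential (\<lambda>u. 1) (Suc CARD('n)) x"
proof -
  obtain y where y: "y \<in> dual_slice" "x0 \<bullet> y = 0"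
    using supporting_dual_slice[OF x0] .
  define N where "N = real CARD('n)"
  have N: "1 \<le> N"
    by (simp add: N_def Suc_leI)
  define L where "L = 2 + norm x0"
  have L: "0 < L"
    unfolding L_def by (simp add: add_pos_nonneg)
  show ?thesis
  proof (rule that)
    show "0 < 1 / (N ^ CARD('n) * L ^ Suc CARD('n))"
      using N L by simp
    fix x
    assume x: "x \<in> \<Gamma>" and near: "norm (x - x0) \<le> 1"
    define r where "r = norm (x - x0)"
    have r: "0 < r" "r \<le> 1"
      using x x0 near open_cone by (auto simp: r_def frontier_def interior_open)
    \<comment> \<open>The point \<open>y\<close> has the same relative position in this cube of side \<open>r / N\<close> as in the
      unit cube, which keeps the small cube inside the unit cube.\<close>
    define a b :: "real ^ 'n" where "a = (\<chi> i. y $ i * (1 - r / N))" and "b = (\<chi> i. y $ i * (1 - r / N) + r / N)"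
    have rN: "0 < r / N" "r / N \<le> 1"
      using r N by (simp_all add: pos_divide_le_eq)
    have mem: "0 \<le> a $ i" "a $ i \<le> y $ i" "y $ i \<le> b $ i" "b $ i \<le> 1" for i
    proof -
      have yi: "0 \<le> y $ i" "y $ i \<le> 1"
        using dual_slice_nonneg[OF y(1)] dual_slice_le_1[OF y(1)] by auto
      have "0 \<le> (r / N) * y $ i" "(r / N) * y $ i \<le> r / N"
        using rN yi by (intro mult_nonneg_nonneg, simp_all only: less_imp_le mult_left_le)
      moreover have "0 \<le> (1 - r / N) * y $ i" "(1 - r / N) * y $ i \<le> 1 - r / N"
        using rN yi by (simp_all add: mult_left_le)
      ultimately show "0 \<le> a $ i" "a $ i \<le> y $ i" "y $ i \<le> b $ i" "b $ i \<le> 1"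
        by (simp_all add: a_def b_def algebra_simps)
    qed
    have "x \<bullet> proj u \<le> r * L" if u: "u \<in> cbox a b" for u
    proof -
      have "\<bar>(u - y) $ i\<bar> \<le> r / N" for i
      proof -
        have "a $ i \<le> u $ i" "u $ i \<le> b $ i"
          using u by (auto simp: mem_box_cart)
        moreover have "b $ i = a $ i + r / N"
          by (simp add: a_def b_def)
        ultimately show ?thesis
          using mem(2,3)[of i] by (simp add: abs_le_iff)
      qed
      then have "(\<Sum>i\<in>UNIV. \<bar>(u - y) $ i\<bar>) \<le> of_nat CARD('n) * (r / N)"
        by (intro sum_bounded_above) auto
      then have "norm (u - y) \<le> r"
        using norm_le_l1_cart[of "u - y"] N by (simp add: N_def)
      moreover have "norm (proj u - y) \<le> norm (u - y)"
        using closest_point_lipschitz[OF convex_dual_slice closed_dual_slice dual_slice_nonempty, of u y]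
          closest_point_self[OF y(1)] by (simp add: proj_def dist_norm)
      ultimately have near_y: "norm (proj u - y) \<le> r"
        by linarith
      have "norm x \<le> 1 + norm x0"
        using near norm_triangle_ineq[of "x - x0" x0] by simp
      have "x \<bullet> proj u = (x - x0) \<bullet> y + x \<bullet> (proj u - y)"
        using y(2) by (simp add: inner_simps)
      also have "\<dots> \<le> norm (x - x0) * norm y + norm x * norm (proj u - y)"
        by (intro add_mono norm_cauchy_schwarz)
      also have "\<dots> \<le> r * 1 + (1 + norm x0) * r"
        using near_y \<open>norm x \<le> 1 + norm x0\<close> norm_dual_slice[OF y(1)]
        by (intro add_mono mult_mono) (auto simp: r_def)
      also have "\<dots> = r * L"
        by (simp add: L_def algebra_simps)
      finally show ?thesis .
    qed
    moreover have "y \<in> cbox a b"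
      using mem(2,3) by (simp add: mem_box_cart)
    then have ne: "cbox a b \<noteq> {}"
      by blast
    ultimately have "measure lborel (cbox a b) / (r * L) ^ Suc CARD('n) \<le> potential (\<lambda>u. 1) (Suc CARD('n)) x"
    proof (intro potential_one_ge x ne)
      show "cbox a b \<subseteq> cbox 0 1"
        unfolding subset_iff mem_box_cart zero_index one_index
        using mem(1,4) by (meson order_trans)
    qed
    moreover have "measure lborel (cbox a b) = (r / N) ^ CARD('n)"
      by (subst content_cbox_cart[OF ne]) (simp add: a_def b_def)
    moreover have "(r / N) ^ CARD('n) / (r * L) ^ Suc CARD('n) = 1 / (N ^ CARD('n) * L ^ Suc CARD('n)) / r"
      using r N L by (simp add: power_divide power_mult_distrib field_simps)
    ultimately show "1 / (N ^ CARD('n) * L ^ Suc CARD('n)) / norm (x - x0) \<le> potential (\<lambda>u. 1) (Suc CARD('n)) x"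
      by (simp add: r_def)
  qed
qed

lemma mean_tendsto_frontier:
  assumes x0: "x0 \<in> frontier \<Gamma>"
  shows "(mean \<longlongrightarrow> 0) (at x0 within \<Gamma>)"
proof -
  obtain c where c: "0 < c"
    and lower: "\<And>x. x \<in> \<Gamma> \<Longrightarrow> norm (x - x0) \<le> 1 \<Longrightarrow> c / norm (x - x0) \<le> potential (\<lambda>u. 1) (Suc CARD('n)) x"
    using potential_one_near_frontier[OF x0] by blast
  have "((\<lambda>x. norm (x - x0)) \<longlongrightarrow> 0) (at x0 within \<Gamma>)"
    by (intro tendsto_eq_intros) auto
  moreover have "eventually (\<lambda>x. 0 < norm (x - x0)) (at x0 within \<Gamma>)"
    by (auto simp: eventually_at_filter)
  ultimately have "filterlim (\<lambda>x. c / norm (x - x0)) at_top (at x0 within \<Gamma>)"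
    by (intro LIM_at_top_divide[OF tendsto_const c])
  moreover have "eventually (\<lambda>x. c / norm (x - x0) \<le> potential (\<lambda>u. 1) (Suc CARD('n)) x) (at x0 within \<Gamma>)"
    unfolding eventually_at by (rule exI[of _ 1]) (auto intro!: lower simp: dist_norm)
  ultimately have "filterlim (potential (\<lambda>u. 1) (Suc CARD('n))) at_top (at x0 within \<Gamma>)"
    by (rule filterlim_at_top_mono)
  then show ?thesis
    unfolding mean_def[abs_def] by (intro tendsto_neg_powr) auto
qed

end

section \<open>The defining function of the cone\<close>

context symmetric_cone
begin

text \<open>The weighted geometric mean of \<open>mean x\<close> and the coordinate sum, with weights \<open>1 / n\<close> and
  \<open>1 - 1 / n\<close>.  On the positive orthant the first is at least the smallest coordinate and the
  second at least the largest, so that these weights give a bound by the geometric mean of the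
  coordinates.  Outside \<open>\<Gamma>\<close> the value \<open>0\<close> provides the boundary values.\<close>

definition profile :: "real ^ 'n \<Rightarrow> real" where
  "profile x = (if x \<in> \<Gamma>
    then (mean x * (\<Sum>i\<in>UNIV. x $ i) ^ (CARD('n) - 1)) powr (1 / CARD('n)) else 0)"

lemma profile_arg_pos: "x \<in> \<Gamma> \<Longrightarrow> 0 < mean x * (\<Sum>i\<in>UNIV. x $ i) ^ (CARD('n) - 1)"
  by (simp add: mean_pos sum_pos)

lemma profile_pos:
  assumes "x \<in> \<Gamma>"
  shows "0 < profile x"
  unfolding profile_def if_P[OF assms] powr_gt_zero using profile_arg_pos[OF assms]
  by (rule less_imp_neq[THEN not_sym])

lemma profile_power:
  assumes "x \<in> \<Gamma>"
  shows "profile x ^ CARD('n) = mean x * (\<Sum>i\<in>UNIV. x $ i) ^ (CARD('n) - 1)"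
proof -
  have "(a powr (1 / CARD('n))) ^ CARD('n) = a" if "0 < a" for a :: real
  proof -
    have "(a powr (1 / CARD('n))) ^ CARD('n) = (a powr (1 / CARD('n))) powr real CARD('n)"
      using that by (subst powr_realpow) auto
    also have "\<dots> = a"
      using that by (simp add: powr_powr)
    finally show ?thesis .
  qed
  from this[OF profile_arg_pos[OF assms]] show ?thesis
    unfolding profile_def if_P[OF assms] .
qed

lemma profile_eq_geometric_mean:
  assumes "x \<in> \<Gamma>"
  shows "profile x = mean x powr (1 / CARD('n)) * (\<Sum>i\<in>UNIV. x $ i) powr (1 - 1 / CARD('n))"
proof -
  have "real (CARD('n) - 1) / CARD('n) = 1 - 1 / CARD('n)"
    by (simp add: of_nat_diff diff_divide_distrib)
  then show ?thesis
    using assms mean_pos[OF assms] sum_pos[OF assms]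
    by (simp add: profile_def powr_mult powr_powr flip: powr_realpow)
qed

lemma profile_permute:
  assumes p: "p permutes UNIV"
  shows "profile (permute_vec p x) = profile x"
proof -
  have "permute_vec p x \<in> \<Gamma> \<longleftrightarrow> x \<in> \<Gamma>"
    using permute_in_cone_iff[OF p] by (simp add: permute_vec_def)
  moreover have "(\<Sum>i\<in>UNIV. permute_vec p x $ i) = (\<Sum>i\<in>UNIV. x $ i)"
    using sum.permute[OF p, of "\<lambda>i. x $ i"] by (simp add: o_def)
  ultimately show ?thesis
    unfolding profile_def using mean_permute[OF p] by simp
qed

lemma profile_scale:
  assumes t: "0 < t"
  shows "profile (t *\<^sub>R x) = t * profile x"
proof (cases "x \<in> \<Gamma>")
  case True
  show ?thesis
  proof (rule power_eq_imp_eq_base)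
    have "profile (t *\<^sub>R x) ^ CARD('n)
        = (t * mean x) * (t * (\<Sum>i\<in>UNIV. x $ i)) ^ (CARD('n) - 1)"
      by (simp add: profile_power[OF scale_in_cone[OF True t]] mean_scale[OF True t]
          flip: sum_distrib_left)
    also have "\<dots> = (t * t ^ (CARD('n) - 1)) * profile x ^ CARD('n)"
      by (simp add: profile_power[OF True] power_mult_distrib)
    also have "t * t ^ (CARD('n) - 1) = t ^ CARD('n)"
      by (subst (2) power_eq_if) simp
    finally show "profile (t *\<^sub>R x) ^ CARD('n) = (t * profile x) ^ CARD('n)"
      by (simp add: power_mult_distrib)
  qed (use t profile_pos[OF True] profile_pos[OF scale_in_cone[OF True t]] in auto)
next
  case False
  then show ?thesis
    by (simp add: profile_def scale_in_cone_iff[OF t])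
qed

lemma profile_superadditive:
  assumes x: "x \<in> \<Gamma>" and y: "y \<in> \<Gamma>"
  shows "profile x + profile y \<le> profile (x + y)"
proof -
  let ?s = "\<lambda>x :: real ^ 'n. \<Sum>i\<in>UNIV. x $ i"
  let ?\<alpha> = "1 / real CARD('n)"
  have s: "?s (x + y) = ?s x + ?s y"
    by (simp add: sum.distrib)
  have "profile x + profile y \<le> (mean x + mean y) powr ?\<alpha> * (?s x + ?s y) powr (1 - ?\<alpha>)"
    unfolding profile_eq_geometric_mean[OF x] profile_eq_geometric_mean[OF y]
    by (rule weighted_geometric_mean_superadditive)
      (auto simp: mean_pos sum_pos x y divide_le_eq_1 Suc_le_eq)
  also have "\<dots> \<le> mean (x + y) powr ?\<alpha> * (?s x + ?s y) powr (1 - ?\<alpha>)"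
    using mean_superadditive[OF x y] mean_pos[OF x] mean_pos[OF y]
    by (intro mult_right_mono powr_mono2) auto
  also have "\<dots> = profile (x + y)"
    by (simp only: profile_eq_geometric_mean[OF add_in_cone[OF x y]] s)
  finally show ?thesis .
qed

lemma profile_concave: "concave_on \<Gamma> profile"
  unfolding concave_on_iff
proof (intro conjI ballI allI impI convex_cone)
  fix x y and u v :: real
  assume x: "x \<in> \<Gamma>" and y: "y \<in> \<Gamma>" and uv: "0 \<le> u" "0 \<le> v" "u + v = 1"
  show "u * profile x + v * profile y \<le> profile (u *\<^sub>R x + v *\<^sub>R y)"
  proof (cases "u = 0 \<or> v = 0")
    case True
    then show ?thesis
      using uv(3) by auto
  next
    case False
    then have "0 < u" "0 < v"
      using uv by auto
    then show ?thesis
      using profile_superadditive[OF scale_in_cone[OF x] scale_in_cone[OF y], of u v]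
      by (simp add: profile_scale)
  qed
qed

lemma profile_smooth: "smooth_on \<Gamma> profile"
  unfolding smooth_on_def
proof
  fix k
  have "Ck_on k \<Gamma> mean"
    unfolding mean_def[abs_def]
    by (intro Ck_on_powr open_cone Ck_on_potential potential_one_pos) simp
  moreover have "Ck_on k \<Gamma> (\<lambda>x. \<Sum>i\<in>UNIV. x $ i)"
    by (intro Ck_on_bounded_linear open_cone bounded_linear_sum bounded_linear_vec_nth)
  ultimately have "Ck_on k \<Gamma> (\<lambda>x. (mean x * (\<Sum>i\<in>UNIV. x $ i) ^ (CARD('n) - 1)) powr (1 / CARD('n)))"
    by (intro Ck_on_powr Ck_on_mult Ck_on_power open_cone profile_arg_pos)
  then show "Ck_on k \<Gamma> profile"
    by (rule Ck_on_cong[OF open_cone, rotated]) (simp add: profile_def)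
qed

lemma profile_frontier: "x \<in> frontier \<Gamma> \<Longrightarrow> profile x = 0"
  using open_cone by (simp add: profile_def frontier_def interior_open)

lemma profile_continuous: "continuous_on (closure \<Gamma>) profile"
  unfolding continuous_on_def
proof
  fix x0
  assume "x0 \<in> closure \<Gamma>"
  show "(profile \<longlongrightarrow> profile x0) (at x0 within closure \<Gamma>)"
  proof (cases "x0 \<in> \<Gamma>")
    case True
    have "continuous_on \<Gamma> profile"
      using profile_smooth unfolding smooth_on_def by (metis Ck_on.simps(1))
    then have "isCont profile x0"
      using True open_cone continuous_on_eq_continuous_at by blast
    then show ?thesis
      unfolding isCont_def by (rule tendsto_within_subset) simp
  next
    case False
    then have x0: "x0 \<in> frontier \<Gamma>"
      using \<open>x0 \<in> closure \<Gamma>\<close> open_cone by (simp add: frontier_def interior_open)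
    let ?F = "at x0 within \<Gamma>"
    have "((\<lambda>x. mean x * (\<Sum>i\<in>UNIV. x $ i) ^ (CARD('n) - 1))
        \<longlongrightarrow> 0 * (\<Sum>i\<in>UNIV. x0 $ i) ^ (CARD('n) - 1)) ?F"
      by (intro tendsto_intros mean_tendsto_frontier[OF x0])
    then have "((\<lambda>x. (mean x * (\<Sum>i\<in>UNIV. x $ i) ^ (CARD('n) - 1)) powr (1 / CARD('n)))
        \<longlongrightarrow> 0 powr (1 / CARD('n))) ?F"
      by (intro tendsto_powr' tendsto_const)
        (auto simp: eventually_at_filter simp del: One_nat_def
          intro!: always_eventually less_imp_le[OF profile_arg_pos])
    then have "(profile \<longlongrightarrow> 0 powr (1 / CARD('n))) ?F"
      by (rule Lim_transform_eventually) (auto simp: eventually_at_filter profile_def)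
    then have "(profile \<longlongrightarrow> 0) ?F"
      by simp
    moreover have "(profile \<longlongrightarrow> 0) (at x0 within closure \<Gamma> - \<Gamma>)"
      by (rule tendsto_eventually) (auto simp: eventually_at_filter profile_def)
    ultimately have "(profile \<longlongrightarrow> 0) (at x0 within \<Gamma> \<union> (closure \<Gamma> - \<Gamma>))"
      by (simp only: Lim_within_Un)
    moreover have "\<Gamma> \<union> (closure \<Gamma> - \<Gamma>) = closure \<Gamma>"
      using closure_subset by blast
    ultimately show ?thesis
      by (simp add: profile_frontier[OF x0])
  qed
qed

text \<open>Bound the smallest coordinate by the mean and each of the other \<open>n - 1\<close> by the coordinate
  sum.\<close>

lemma profile_power_ge_prod:
  assumes x: "x \<in> Gamma_n"
  shows "(\<Prod>i\<in>UNIV. x $ i) \<le> profile x ^ CARD('n)"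
proof -
  have pos: "0 < x $ i" for i
    using x by (simp add: Gamma_n_def)
  obtain k where k: "\<And>i. x $ k \<le> x $ i"
    using ex_is_arg_min_if_finite[of UNIV "\<lambda>i. x $ i"] by (auto simp: is_arg_min_linorder)
  have \<Gamma>: "x \<in> \<Gamma>"
    using x Gamma_n_subset by blast
  have "(\<Prod>i\<in>UNIV. x $ i) = x $ k * (\<Prod>i\<in>UNIV - {k}. x $ i)"
    by (rule prod.remove) auto
  also have "\<dots> \<le> mean x * (\<Sum>i\<in>UNIV. x $ i) ^ (CARD('n) - 1)"
  proof (rule mult_mono)
    show "x $ k \<le> mean x"
      by (rule mean_ge_of_coordinates_ge[OF \<Gamma> pos k])
    have "(\<Prod>i\<in>UNIV - {k}. x $ i) \<le> (\<Prod>i\<in>UNIV - {k}. \<Sum>i\<in>UNIV. x $ i)"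
      using pos member_le_sum[of _ UNIV "($) x"] by (intro prod_mono) (auto intro: less_imp_le)
    then show "(\<Prod>i\<in>UNIV - {k}. x $ i) \<le> (\<Sum>i\<in>UNIV. x $ i) ^ (CARD('n) - 1)"
      by (simp add: card_Diff_singleton)
  qed (use mean_pos[OF \<Gamma>] pos in \<open>auto intro: prod_nonneg less_imp_le\<close>)
  finally show ?thesis
    by (simp add: profile_power[OF \<Gamma>])
qed

end

section \<open>Gradients\<close>

lemma smooth_on_gradient:
  fixes f :: "real ^ 'n \<Rightarrow> real"
  assumes f: "smooth_on S f"
  obtains g where "\<And>x. x \<in> S \<Longrightarrow> (f has_derivative (\<lambda>v. g x \<bullet> v)) (at x)"
    and "continuous_on S g"
proof -
  define g where "g x = (\<chi> i. frechet_derivative f (at x) (axis i 1))" for x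
  have C1: "Ck_on (Suc 0) S f"
    using f by (simp only: smooth_on_def)
  have "(f has_derivative (\<lambda>v. g x \<bullet> v)) (at x)" if "x \<in> S" for x
  proof -
    let ?L = "frechet_derivative f (at x)"
    have der: "(f has_derivative ?L) (at x)"
      by (rule Ck_on_Suc_has_derivative[OF C1 that])
    have lin: "linear ?L"
      by (rule has_derivative_linear[OF der])
    have "?L v = g x \<bullet> v" for v
    proof -
      have "?L v = ?L (\<Sum>i\<in>UNIV. v $ i *\<^sub>R axis i 1)"
        using basis_expansion[of v] by (simp add: scalar_mult_eq_scaleR)
      also have "\<dots> = g x \<bullet> v"
        by (simp add: linear_sum[OF lin] linear_scale[OF lin] g_def inner_vec_def mult.commute)
      finally show ?thesis .
    qed
    then have "?L = (\<lambda>v. g x \<bullet> v)"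
      by (rule ext)
    with der show ?thesis
      by simp
  qed
  moreover have "continuous_on S g"
    unfolding g_def using C1 by (intro continuous_on_vec_lambda) simp
  ultimately show ?thesis
    by (rule that)
qed

lemma partial_deriv_eq:
  fixes f :: "real ^ 'n \<Rightarrow> real"
  assumes "(f has_derivative (\<lambda>v. w \<bullet> v)) (at x)"
  shows "partial_deriv i f x = w $ i"
proof -
  have "((\<lambda>t. x + t *\<^sub>R axis i 1) has_derivative (\<lambda>t. t *\<^sub>R axis i 1)) (at 0)"
    by (auto intro!: derivative_eq_intros)
  from has_derivative_compose[OF this, of f "\<lambda>v. w \<bullet> v"] assms
  have "((\<lambda>t. f (x + t *\<^sub>R axis i 1)) has_real_derivative w $ i) (at 0)"
    by (simp add: has_field_derivative_def inner_axis mult_commute_abs)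
  then show ?thesis
    unfolding partial_deriv_def by (rule DERIV_imp_deriv)
qed

text \<open>Evaluating the hypothesis at \<open>x\<^sub>i = 1 / w\<^sub>i\<close> gives the bound on the product.  The \<open>w\<^sub>k\<close> have to be
  positive: otherwise enlarging the coordinate \<open>k\<close> of \<open>x\<close> makes the product of coordinates grow
  while \<open>w \<bullet> x\<close> does not.\<close>

lemma prod_ge_of_dual_arithmetic_geometric:
  fixes w :: "real ^ 'n"
  assumes nonneg: "\<And>x. x \<in> Gamma_n \<Longrightarrow> 0 \<le> w \<bullet> x"
    and ge: "\<And>x. x \<in> Gamma_n \<Longrightarrow> (\<Prod>i\<in>UNIV. x $ i) \<le> (w \<bullet> x) ^ CARD('n)"
  shows "0 < w $ k" and "1 / real CARD('n) ^ CARD('n) \<le> (\<Prod>i\<in>UNIV. w $ i)"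
proof -
  have pos: "0 < w $ k" for k
  proof (rule ccontr)
    assume "\<not> 0 < w $ k"
    then have wk: "w $ k \<le> 0"
      by simp
    \<comment> \<open>With this increment the product of the coordinates exceeds \<open>(w \<bullet> 1) ^ n\<close>.\<close>
    define x :: "real ^ 'n" where "x = 1 + ((w \<bullet> 1) ^ CARD('n)) *\<^sub>R axis k 1"
    have 1: "(1 :: real ^ 'n) \<in> Gamma_n"
      by (simp add: Gamma_n_def)
    have t: "0 \<le> (w \<bullet> 1) ^ CARD('n)"
      using nonneg[OF 1] by simp
    have x: "x \<in> Gamma_n"
      using t by (auto simp: Gamma_n_def x_def axis_def intro!: add_pos_nonneg)
    have "(\<Prod>i\<in>UNIV. x $ i) = x $ k * (\<Prod>i\<in>UNIV - {k}. x $ i)"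
      by (rule prod.remove) auto
    also have "(\<Prod>i\<in>UNIV - {k}. x $ i) = 1"
      by (rule prod.neutral) (auto simp: x_def axis_def)
    finally have "1 + (w \<bullet> 1) ^ CARD('n) \<le> (w \<bullet> x) ^ CARD('n)"
      using ge[OF x] by (simp add: x_def axis_def)
    also have "\<dots> \<le> (w \<bullet> 1) ^ CARD('n)"
    proof (rule power_mono[OF _ nonneg[OF x]])
      show "w \<bullet> x \<le> w \<bullet> 1"
        using t wk by (simp add: x_def inner_add_right inner_axis mult_nonneg_nonpos)
    qed
    finally show False
      by simp
  qed
  show "0 < w $ k"
    by (rule pos)
  define y :: "real ^ 'n" where "y = (\<chi> i. 1 / w $ i)"
  have "y \<in> Gamma_n"
    using pos by (simp add: Gamma_n_def y_def)
  moreover have "w \<bullet> y = real CARD('n)"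
    using pos by (simp add: inner_vec_def y_def less_imp_neq[symmetric])
  ultimately have "1 / (\<Prod>i\<in>UNIV. w $ i) \<le> real CARD('n) ^ CARD('n)"
    using ge[of y] by (simp add: y_def prod_dividef)
  moreover have "0 < (\<Prod>i\<in>UNIV. w $ i)"
    by (simp add: prod_pos pos)
  ultimately show "1 / real CARD('n) ^ CARD('n) \<le> (\<Prod>i\<in>UNIV. w $ i)"
    by (simp add: field_simps)
qed

theorem theorem1p3:
  fixes \<Gamma> :: "(real ^ 'n) set"
  assumes "open \<Gamma>" and "symmetric_set \<Gamma>" and "convex \<Gamma>" and "dilation_invariant \<Gamma>"
    and "Gamma_n \<subseteq> \<Gamma>" and "\<Gamma> \<subseteq> Gamma_1"
  shows "\<exists>f :: real ^ 'n \<Rightarrow> real.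
    symmetric_on (closure \<Gamma>) f \<and> smooth_on \<Gamma> f \<and> continuous_on (closure \<Gamma>) f \<and>
    (\<forall>x\<in>\<Gamma>. \<forall>i. partial_deriv i f x > 0) \<and>
    concave_on \<Gamma> f \<and> (\<forall>x\<in>\<Gamma>. f x > 0) \<and> (\<forall>x\<in>frontier \<Gamma>. f x = 0) \<and>
    (\<forall>x\<in>closure \<Gamma>. \<forall>t>0. f (t *\<^sub>R x) = t * f x) \<and>
    (\<exists>\<gamma>\<^sub>0>0. \<forall>A U :: complex ^ 'n ^ 'n.
       hermitian A \<and> eigvals A \<in> \<Gamma> \<and> unitary U \<longrightarrow>
       (\<exists>G. has_hermitian_gradient
              (\<lambda>B. spectral_fun f (U ** B ** conj_transpose U)) (conj_transpose U ** A ** U) G \<and>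
            det G \<in> \<real> \<and> Re (det G) \<ge> \<gamma>\<^sub>0))"
proof -
  interpret symmetric_cone \<Gamma>
    by unfold_locales (fact assms)+
  obtain g where der: "\<And>x. x \<in> \<Gamma> \<Longrightarrow> (profile has_derivative (\<lambda>v. g x \<bullet> v)) (at x)"
    and cont: "continuous_on \<Gamma> g"
    using smooth_on_gradient[OF profile_smooth] by blast
  have profile_sym: "symmetric_on S profile" for S
    using profile_permute by (simp add: symmetric_on_def permute_vec_def)
  interpret symmetric_concave \<Gamma> profile g
    by unfold_locales (fact assms(1) assms(2) profile_sym profile_concave cont der)+
  define \<gamma>\<^sub>0 where "\<gamma>\<^sub>0 = 1 / real CARD('n) ^ CARD('n)"
  have "0 < \<gamma>\<^sub>0"
    by (simp add: \<gamma>\<^sub>0_def)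
  \<comment> \<open>Homogeneity and concavity: the slope at any \<open>x\<close> dominates the function itself.\<close>
  have grad_ge: "profile v \<le> g x \<bullet> v" if x: "x \<in> \<Gamma>" and v: "v \<in> \<Gamma>" for x v
    using profile_superadditive[OF x v] below_tangent[OF x add_in_cone[OF x v]] by simp
  have grad: "0 < g x $ i" "\<gamma>\<^sub>0 \<le> (\<Prod>i\<in>UNIV. g x $ i)" if x: "x \<in> \<Gamma>" for x i
  proof -
    have nonneg: "0 \<le> g x \<bullet> v" if "v \<in> Gamma_n" for v
      using that Gamma_n_subset grad_ge[OF x, of v] profile_pos[of v] by (auto intro: less_imp_le less_le_trans)
    have ge: "(\<Prod>i\<in>UNIV. v $ i) \<le> (g x \<bullet> v) ^ CARD('n)" if v: "v \<in> Gamma_n" for v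
    proof -
      have "profile v ^ CARD('n) \<le> (g x \<bullet> v) ^ CARD('n)"
        using v Gamma_n_subset grad_ge[OF x, of v] profile_pos[of v] by (intro power_mono) auto
      with profile_power_ge_prod[OF v] show ?thesis
        by linarith
    qed
    show "0 < g x $ i" "\<gamma>\<^sub>0 \<le> (\<Prod>i\<in>UNIV. g x $ i)"
      unfolding \<gamma>\<^sub>0_def using prod_ge_of_dual_arithmetic_geometric[OF nonneg ge] by blast+
  qed
  have spectral: "\<exists>G. has_hermitian_gradient
        (\<lambda>B. spectral_fun profile (U ** B ** conj_transpose U)) (conj_transpose U ** A ** U) G \<and>
      det G \<in> \<real> \<and> Re (det G) \<ge> \<gamma>\<^sub>0"
    if A: "hermitian A" "eigvals A \<in> \<Gamma>" and U: "unitary U" for A U :: "complex ^ 'n ^ 'n"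
  proof -
    define A' where "A' = conj_transpose U ** A ** U"
    have "eigvals A' = eigvals A" "hermitian A'"
      unfolding A'_def using eigvals_conj_unitary[OF unitary_conj_transpose[OF U], of A]
        hermitian_conj[OF A(1), of "conj_transpose U"] by simp_all
    then obtain G where G: "has_hermitian_gradient (spectral_fun profile) A' G"
      "det G = complex_of_real (\<Prod>i\<in>UNIV. g (eigvals A) $ i)"
      using spectral_has_hermitian_gradient[of A'] A(2) by metis
    have "(\<lambda>B. spectral_fun profile (U ** B ** conj_transpose U)) = spectral_fun profile"
      by (simp add: spectral_fun_def eigvals_conj_unitary[OF U] fun_eq_iff)
    with G grad(2)[OF A(2)] show ?thesis
      unfolding A'_def by (intro exI[of _ G]) (simp del: of_real_prod)
  qed
  show ?thesis
  proof (intro exI[of _ profile] conjI ballI allI impI)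
    show "\<exists>\<gamma>\<^sub>0>0. \<forall>A U :: complex ^ 'n ^ 'n.
        hermitian A \<and> eigvals A \<in> \<Gamma> \<and> unitary U \<longrightarrow>
        (\<exists>G. has_hermitian_gradient
               (\<lambda>B. spectral_fun profile (U ** B ** conj_transpose U)) (conj_transpose U ** A ** U) G \<and>
             det G \<in> \<real> \<and> Re (det G) \<ge> \<gamma>\<^sub>0)"
      using \<open>0 < \<gamma>\<^sub>0\<close> spectral by blast
  qed (simp_all add: profile_sym profile_smooth profile_continuous profile_concave profile_pos
      profile_frontier profile_scale partial_deriv_eq[OF der] grad(1))
qed

end
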